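(* Let $\mathcal{H}$ be a finite dimensional complex Hilbert space and let $\mathsf{A}=\{\mathsf{A}_x\}$ and $\mathsf{B}=\{\mathsf{B}_y\}$ be observables on $\mathcal{H}$ with finitely many outcomes. Define $$D_{\mathsf{A}}(\mathsf{B}):=\inf\big\{\lambda\in[0,1] \;:\; -\lambda\mathbb{1}\le \mathsf{B}_y-\mathcal{I}_\Omega^*(\mathsf{B}_y)\le\lambda\mathbb{1}\ \text{ for all } y\big\},$$ where the infimum is taken over all $\lambda$ and over all instruments $\mathcal{I}$ implementing $\mathsf{A}$. Then the infimum is attained (so that $D_{\mathsf{A}}(\mathsf{B})=0$ if and only if $\mathsf{A}$ can be measured without disturbing $\mathsf{B}$), and $$D_{\mathsf{A}}(\mathsf{B})=\sup\Big(\sum_x\mathrm{tr}[H_x\mathsf{A}_x]-\sum_y\mathrm{tr}[K_y\mathsf{B}_y]\Big),$$ where the supremum is taken over all families of selfadjoint operators $\{H_x\}$, $\{K_y\}$ on $\mathcal{H}$ satisfying $H_x\otimes\mathbb{1}\le\sum_y K_y\otimes\mathsf{B}_y^T$ for all $x$, and $\sum_y\mathrm{tr}[|K_y|]=1$.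
   Context: An observable on $\mathcal{H}$ is a family $\mathsf{A}=\{\mathsf{A}_x\}_{x\in\Omega_{\mathsf{A}}}$ of positive operators on $\mathcal{H}$ with $\sum_x\mathsf{A}_x=\mathbb{1}$ (a discrete POVM). An instrument implementing $\mathsf{A}$ is a family $\mathcal{I}=\{\mathcal{I}_x\}_{x\in\Omega_{\mathsf{A}}}$ of completely positive linear maps on the operators on $\mathcal{H}$ such that $\mathcal{I}_x^*(\mathbb{1})=\mathsf{A}_x$ for all $x$; here the adjoint $\mathcal{I}_x^*$ is defined by $\mathrm{tr}[X\,\mathcal{I}_x(Y)]=\mathrm{tr}[\mathcal{I}_x^*(X)Y]$ for all $X,Y$. Put $\mathcal{I}_\Omega:=\sum_x\mathcal{I}_x$, with adjoint $\mathcal{I}_\Omega^*$. $\mathsf{A}$ can be measured without disturbing $\mathsf{B}$ if there is an instrument $\mathcal{I}$ implementing $\mathsf{A}$ with $\mathcal{I}_\Omega^*(\mathsf{B}_y)=\mathsf{B}_y$ for all $y\in\Omega_{\mathsf{B}}$. The transpose $T$ is taken with respect to a fixed orthonormal basis of $\mathcal{H}$, and $|K|=\sqrt{K^*K}$. *)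

theory Defs
  imports "HOL-Analysis.Analysis"
begin

text \<open>
  The Hilbert space is \<open>complex^'n\<close>, with the standard basis as the fixed orthonormal basis;
  operators are square matrices. Outcome sets are finite types.
\<close>

type_synonym 'n op = "complex^'n^'n"

definition cinner :: "complex^'n \<Rightarrow> complex^'n \<Rightarrow> complex" where
  "cinner v w = (\<Sum>i\<in>UNIV. cnj (v $ i) * w $ i)"

definition adj :: "'n::finite op \<Rightarrow> 'n op" where
  "adj A = (\<chi> i j. cnj (A $ j $ i))"

definition selfadj :: "'n::finite op \<Rightarrow> bool" where
  "selfadj A \<longleftrightarrow> adj A = A"

definition nonneg_complex :: "complex \<Rightarrow> bool" where
  "nonneg_complex z \<longleftrightarrow> z \<in> \<real> \<and> 0 \<le> Re z"

definition pos_op :: "'n::finite op \<Rightarrow> bool" where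
  "pos_op A \<longleftrightarrow> (\<forall>v. nonneg_complex (cinner v (A *v v)))"

definition loewner_le :: "'n::finite op \<Rightarrow> 'n op \<Rightarrow> bool"  (infix "\<preceq>" 50) where
  "A \<preceq> B \<longleftrightarrow> pos_op (B - A)"

definition op_sqrt :: "'n::finite op \<Rightarrow> 'n op" where
  "op_sqrt A = (THE P. pos_op P \<and> P ** P = A)"

definition op_abs :: "'n::finite op \<Rightarrow> 'n op" where
  "op_abs K = op_sqrt (adj K ** K)"

definition tensor_op :: "'n::finite op \<Rightarrow> 'm::finite op \<Rightarrow> ('n \<times> 'm) op"  (infixl "\<otimes>\<^sub>o" 70) where
  "A \<otimes>\<^sub>o B = (\<chi> p q. A $ fst p $ fst q * B $ snd p $ snd q)"

definition clinear_map :: "('n::finite op \<Rightarrow> 'n op) \<Rightarrow> bool" where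
  "clinear_map \<Phi> \<longleftrightarrow>
     (\<forall>X Y. \<Phi> (X + Y) = \<Phi> X + \<Phi> Y) \<and> (\<forall>c X. \<Phi> (mat c ** X) = mat c ** \<Phi> X)"

text \<open>
  An operator on \<open>C^k\<close> tensor the Hilbert space is given by its blocks \<open>X i j\<close> with
  \<open>i, j < k\<close>, a vector by its components \<open>v i\<close> with \<open>i < k\<close>. Thus \<open>completely_positive\<close> says
  that \<open>id_k\<close> tensor \<open>\<Phi>\<close> is positive for every \<open>k\<close>.
\<close>

definition block_pos :: "nat \<Rightarrow> (nat \<Rightarrow> nat \<Rightarrow> 'n::finite op) \<Rightarrow> bool" where
  "block_pos k X \<longleftrightarrow>
     (\<forall>v :: nat \<Rightarrow> complex^'n. nonneg_complex (\<Sum>i<k. \<Sum>j<k. cinner (v i) (X i j *v v j)))"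

definition completely_positive :: "('n::finite op \<Rightarrow> 'n op) \<Rightarrow> bool" where
  "completely_positive \<Phi> \<longleftrightarrow>
     clinear_map \<Phi> \<and> (\<forall>k X. block_pos k X \<longrightarrow> block_pos k (\<lambda>i j. \<Phi> (X i j)))"

definition tr_adjoint :: "('n::finite op \<Rightarrow> 'n op) \<Rightarrow> ('n op \<Rightarrow> 'n op)" where
  "tr_adjoint \<Phi> = (THE \<Psi>. \<forall>X Y. trace (X ** \<Phi> Y) = trace (\<Psi> X ** Y))"

definition observable :: "('x::finite \<Rightarrow> 'n::finite op) \<Rightarrow> bool" where
  "observable A \<longleftrightarrow> (\<forall>x. pos_op (A x)) \<and> (\<Sum>x\<in>UNIV. A x) = mat 1"

definition implements ::
    "('x::finite \<Rightarrow> 'n::finite op \<Rightarrow> 'n op) \<Rightarrow> ('x \<Rightarrow> 'n op) \<Rightarrow> bool" where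
  "implements \<I> A \<longleftrightarrow>
     (\<forall>x. completely_positive (\<I> x) \<and> tr_adjoint (\<I> x) (mat 1) = A x)"

definition total_map :: "('x::finite \<Rightarrow> 'n::finite op \<Rightarrow> 'n op) \<Rightarrow> 'n op \<Rightarrow> 'n op" where
  "total_map \<I> Y = (\<Sum>x\<in>UNIV. \<I> x Y)"

definition measurable_without_disturbing ::
    "('x::finite \<Rightarrow> 'n::finite op) \<Rightarrow> ('y::finite \<Rightarrow> 'n op) \<Rightarrow> bool" where
  "measurable_without_disturbing A B \<longleftrightarrow>
     (\<exists>\<I>. implements \<I> A \<and> (\<forall>y. tr_adjoint (total_map \<I>) (B y) = B y))"

definition disturbance_set ::
    "('x::finite \<Rightarrow> 'n::finite op) \<Rightarrow> ('y::finite \<Rightarrow> 'n op) \<Rightarrow> real set" where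
  "disturbance_set A B = {t. 0 \<le> t \<and> t \<le> 1 \<and>
     (\<exists>\<I>. implements \<I> A \<and>
        (\<forall>y. (- t) *\<^sub>R mat 1 \<preceq> B y - tr_adjoint (total_map \<I>) (B y) \<and>
             B y - tr_adjoint (total_map \<I>) (B y) \<preceq> t *\<^sub>R mat 1))}"

definition disturbance ::
    "('x::finite \<Rightarrow> 'n::finite op) \<Rightarrow> ('y::finite \<Rightarrow> 'n op) \<Rightarrow> real" where
  "disturbance A B = Inf (disturbance_set A B)"

definition dual_feasible ::
    "('y::finite \<Rightarrow> 'n::finite op) \<Rightarrow> ('x::finite \<Rightarrow> 'n op) \<Rightarrow> ('y \<Rightarrow> 'n op) \<Rightarrow> bool" where
  "dual_feasible B H K \<longleftrightarrow>
     (\<forall>x. selfadj (H x)) \<and> (\<forall>y. selfadj (K y)) \<and>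
     (\<forall>x. H x \<otimes>\<^sub>o (mat 1 :: 'n op) \<preceq> (\<Sum>y\<in>UNIV. K y \<otimes>\<^sub>o transpose (B y))) \<and>
     (\<Sum>y\<in>UNIV. trace (op_abs (K y))) = 1"

text \<open>The traces are real for selfadjoint arguments, so \<open>Re\<close> only changes the type.\<close>

definition dual_value ::
    "('x::finite \<Rightarrow> 'n::finite op) \<Rightarrow> ('y::finite \<Rightarrow> 'n op) \<Rightarrow>
     ('x \<Rightarrow> 'n op) \<Rightarrow> ('y \<Rightarrow> 'n op) \<Rightarrow> real" where
  "dual_value A B H K =
     Re ((\<Sum>x\<in>UNIV. trace (H x ** A x)) - (\<Sum>y\<in>UNIV. trace (K y ** B y)))"

definition dual_values ::
    "('x::finite \<Rightarrow> 'n::finite op) \<Rightarrow> ('y::finite \<Rightarrow> 'n op) \<Rightarrow> real set" where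
  "dual_values A B = {dual_value A B H K | H K. dual_feasible B H K}"

end

theory Submission
  imports Defs
begin

text \<open>
  By Choi's theorem the instruments implementing \<open>A\<close> correspond to the families of positive operators
  \<open>C x\<close> on the doubled space whose second partial trace is \<open>A x\<close>; the adjoint map is then the partial
  trace of \<open>C x\<close> times \<open>mat 1 \<otimes>\<^sub>o transpose X\<close>. These families form a compact set, so the infimum is attained.
  Pairing the \<open>C x\<close> with \<open>\<Sum>y. K y \<otimes>\<^sub>o transpose (B y) - H x \<otimes>\<^sub>o mat 1 \<succeq> 0\<close> gives weak duality, because
  the trace norm is dual to the operator norm. For strong duality, if the value \<open>s\<close> is not attainable, then
  the point \<open>(A, - B)\<close> lies outside the convex set of all
  \<open>(choi_dual (C x) (mat 1), R y - (\<Sum>x. choi_dual (C x) (B y)))\<close> with \<open>C x \<succeq> 0\<close> and \<open>- s \<preceq> R y \<preceq> s\<close>. This set is closed,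
  since the first component controls the trace of \<open>C x\<close>, and a strictly separating hyperplane, divided by its
  trace norm, is a dual feasible pair of value larger than \<open>s\<close>.
\<close>

section \<open>The complex inner product and positive operators\<close>

lemma scaleR_vec_nth: "(r *\<^sub>R v) $ i = complex_of_real r * v $ i"
  unfolding vector_scaleR_component by (simp only: scaleR_conv_of_real)

lemma cinner_add_left: "cinner (u + v) w = cinner u w + cinner v w"
  by (simp add: cinner_def distrib_right sum.distrib)

lemma cinner_add_right: "cinner u (v + w) = cinner u v + cinner u w"
  by (simp add: cinner_def distrib_left sum.distrib)

lemma cinner_diff_left: "cinner (u - v) w = cinner u w - cinner v w"
  by (simp add: cinner_def left_diff_distrib sum_subtractf)

lemma cinner_diff_right: "cinner u (v - w) = cinner u v - cinner u w"
  by (simp add: cinner_def right_diff_distrib sum_subtractf)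

lemma cinner_scale_left: "cinner (c *s v) w = cnj c * cinner v w"
  by (simp add: cinner_def sum_distrib_left mult.assoc)

lemma cinner_scale_right: "cinner v (c *s w) = c * cinner v w"
  by (simp add: cinner_def sum_distrib_left mult.left_commute)

lemma cinner_scaleR_left: "cinner (r *\<^sub>R v) w = of_real r * cinner v w"
  by (simp add: cinner_def sum_distrib_left scaleR_vec_nth mult.assoc del: vector_scaleR_component)

lemma cinner_scaleR_right: "cinner v (r *\<^sub>R w) = of_real r * cinner v w"
  by (simp add: cinner_def sum_distrib_left scaleR_vec_nth mult.left_commute del: vector_scaleR_component)

lemma cinner_zero_left [simp]: "cinner 0 w = 0"
  and cinner_zero_right [simp]: "cinner v 0 = 0"
  by (simp_all add: cinner_def)

lemma cinner_sum_right: "cinner v (\<Sum>i\<in>S. f i) = (\<Sum>i\<in>S. cinner v (f i))"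
  by (induction S rule: infinite_finite_induct) (auto simp: cinner_add_right)

lemma cinner_commute: "cinner w v = cnj (cinner v w)"
  by (simp add: cinner_def mult.commute)

lemma cinner_self: "cinner v v = of_real ((norm v)\<^sup>2)"
proof -
  have "cinner v v = (\<Sum>i\<in>UNIV. of_real ((norm (v $ i))\<^sup>2))"
    unfolding cinner_def by (intro sum.cong refl) (metis complex_norm_square mult.commute)
  also have "\<dots> = of_real ((norm v)\<^sup>2)"
    by (simp add: norm_vec_def L2_set_def sum_nonneg)
  finally show ?thesis .
qed

lemma cinner_axis: "cinner (axis i 1) v = v $ i"
  by (simp add: cinner_def axis_def if_distrib if_distribR cong: if_cong)

lemma cinner_mult: "cinner v (A *v w) = (\<Sum>i\<in>UNIV. \<Sum>j\<in>UNIV. cnj (v $ i) * A $ i $ j * w $ j)"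
  by (simp add: cinner_def matrix_vector_mult_def sum_distrib_left mult.assoc)

lemma adj_adj [simp]: "adj (adj A) = A"
  by (simp add: adj_def vec_eq_iff)

lemma cinner_adj: "cinner v (A *v w) = cinner (adj A *v v) w"
proof -
  have "cinner (adj A *v v) w = (\<Sum>j\<in>UNIV. \<Sum>i\<in>UNIV. cnj (v $ i) * A $ i $ j * w $ j)"
    by (simp add: cinner_def adj_def matrix_vector_mult_def sum_distrib_left sum_distrib_right mult_ac)
  then show ?thesis
    unfolding cinner_mult by (subst sum.swap) simp
qed

lemma selfadj_cinner: "selfadj A \<Longrightarrow> cinner v (A *v w) = cinner (A *v v) w"
  by (simp add: cinner_adj selfadj_def)

lemma selfadj_cinner_Im: "selfadj A \<Longrightarrow> Im (cinner v (A *v v)) = 0"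
  by (metis cinner_commute selfadj_cinner Reals_cnj_iff complex_is_Real_iff)

lemma adj_add: "adj (A + B) = adj A + adj B"
  and adj_diff: "adj (A - B) = adj A - adj B"
  and adj_scaleR: "adj (r *\<^sub>R A) = r *\<^sub>R adj A"
  and adj_0 [simp]: "adj 0 = 0"
  by (simp_all add: adj_def vec_eq_iff)

lemma adj_mat_of_real [simp]: "adj (mat (of_real r)) = mat (of_real r)"
  by (auto simp: adj_def vec_eq_iff mat_def)

lemma selfadj_0 [simp]: "selfadj 0"
  and selfadj_mat_1 [simp]: "selfadj (mat 1)"
  using adj_mat_of_real[of 1] by (auto simp: selfadj_def)

lemma selfadj_add: "selfadj A \<Longrightarrow> selfadj B \<Longrightarrow> selfadj (A + B)"
  and selfadj_diff: "selfadj A \<Longrightarrow> selfadj B \<Longrightarrow> selfadj (A - B)"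
  and selfadj_scaleR: "selfadj A \<Longrightarrow> selfadj (r *\<^sub>R A)"
  by (simp_all add: selfadj_def adj_add adj_diff adj_scaleR)

lemma selfadj_sum: "(\<And>i. i \<in> S \<Longrightarrow> selfadj (f i)) \<Longrightarrow> selfadj (\<Sum>i\<in>S. f i)"
  by (induction S rule: infinite_finite_induct) (auto simp: selfadj_add)

lemma scaleR_matrix_vector: "(r *\<^sub>R A) *v (v :: complex^'n) = r *\<^sub>R (A *v v)"
  by (simp add: vec_eq_iff matrix_vector_mult_def scaleR_sum_right)

lemma matrix_vector_scaleR: "(A :: complex^'n^'m) *v (r *\<^sub>R v) = r *\<^sub>R (A *v v)"
  by (simp add: vec_eq_iff matrix_vector_mult_def scaleR_sum_right)

lemma sum_matrix_vector: "(\<Sum>i\<in>S. f i) *v (v :: complex^'n) = (\<Sum>i\<in>S. f i *v v)"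
  by (induction S rule: infinite_finite_induct) (auto simp: matrix_vector_mult_add_rdistrib)

lemma matrix_vector_sum: "(A :: complex^'n^'m) *v (\<Sum>i\<in>S. f i) = (\<Sum>i\<in>S. A *v f i)"
  by (induction S rule: infinite_finite_induct) (auto simp: matrix_vector_right_distrib)

lemma trace_sum: "trace (\<Sum>i\<in>S. f i) = (\<Sum>i\<in>S. trace (f i :: complex^'n^'n))"
  by (induction S rule: infinite_finite_induct) (auto simp: trace_def sum.distrib)

lemma trace_scaleR: "trace (r *\<^sub>R A) = r *\<^sub>R trace (A :: complex^'n^'n)"
  by (simp add: trace_def scaleR_sum_right)

lemma cinner_axis_mult_axis: "cinner (axis i 1) (A *v axis j 1) = A $ i $ j"
  unfolding cinner_axis
  by (simp add: matrix_vector_mult_def axis_def if_distrib if_distribR cong: if_cong)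

lemma nonneg_complex_iff: "nonneg_complex z \<longleftrightarrow> Im z = 0 \<and> 0 \<le> Re z"
  by (auto simp: nonneg_complex_def complex_is_Real_iff)

lemma nonneg_complex_add: "nonneg_complex a \<Longrightarrow> nonneg_complex b \<Longrightarrow> nonneg_complex (a + b)"
  by (simp add: nonneg_complex_iff)

lemma nonneg_complex_sum: "(\<And>i. i \<in> S \<Longrightarrow> nonneg_complex (f i)) \<Longrightarrow> nonneg_complex (\<Sum>i\<in>S. f i)"
  by (simp add: nonneg_complex_iff sum_nonneg)

lemma nonneg_complex_mult: "0 \<le> r \<Longrightarrow> nonneg_complex z \<Longrightarrow> nonneg_complex (of_real r * z)"
  by (simp add: nonneg_complex_iff)

lemma nonneg_complex_cnj_mult: "nonneg_complex (cnj z * z)"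
  by (simp add: nonneg_complex_iff)

lemma pos_opI: "selfadj A \<Longrightarrow> (\<And>v. 0 \<le> Re (cinner v (A *v v))) \<Longrightarrow> pos_op A"
  by (simp add: pos_op_def nonneg_complex_iff selfadj_cinner_Im)

lemma pos_opD: "pos_op A \<Longrightarrow> 0 \<le> Re (cinner v (A *v v))"
  by (simp add: pos_op_def nonneg_complex_iff)

lemma pos_op_0 [simp]: "pos_op 0"
  by (simp add: pos_op_def nonneg_complex_iff)

lemma pos_op_mat_1 [simp]: "pos_op (mat 1)"
  by (simp add: pos_op_def nonneg_complex_iff cinner_self)

lemma pos_op_add: "pos_op A \<Longrightarrow> pos_op B \<Longrightarrow> pos_op (A + B)"
  by (simp add: pos_op_def matrix_vector_mult_add_rdistrib cinner_add_right nonneg_complex_add)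

lemma pos_op_sum: "(\<And>i. i \<in> S \<Longrightarrow> pos_op (f i)) \<Longrightarrow> pos_op (\<Sum>i\<in>S. f i)"
  by (induction S rule: infinite_finite_induct) (auto simp: pos_op_add)

lemma pos_op_scaleR: "0 \<le> r \<Longrightarrow> pos_op A \<Longrightarrow> pos_op (r *\<^sub>R A)"
  by (simp add: pos_op_def scaleR_matrix_vector cinner_scaleR_right nonneg_complex_mult)

text \<open>Polarisation: a quadratic form with only real values comes from a selfadjoint operator.
  Evaluating at \<open>axis i 1 + c *s axis j 1\<close>, the choice \<open>c = 1\<close> compares
  the imaginary parts of the two mirrored entries and \<open>c = \<i>\<close> their real
  parts.\<close>

lemma pos_op_selfadj:
  assumes "pos_op A" shows "selfadj A"
proof -
  have r: "Im (cinner v (A *v v)) = 0" for v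
    using assms by (simp add: pos_op_def nonneg_complex_iff)
  have "cnj (A $ j $ i) = A $ i $ j" for i j
  proof -
    have *: "Im (c * A $ i $ j + cnj c * A $ j $ i) = 0" for c
      using r[of "axis i 1 + c *s axis j 1"] r[of "axis i 1"] r[of "c *s axis j 1"]
      by (simp add: matrix_vector_right_distrib cinner_add_left cinner_add_right
          vector_scalar_commute cinner_scale_left cinner_scale_right cinner_axis_mult_axis algebra_simps)
    show ?thesis
      using *[of 1] *[of \<i>] by (simp add: complex_eq_iff)
  qed
  then show ?thesis by (simp add: selfadj_def adj_def vec_eq_iff)
qed

text \<open>Along the line \<open>u - r *\<^sub>R (A *v u)\<close> the form starts at 0 with slope
  -2 times the squared norm of \<open>A *v u\<close>, so it would become negative unless
  \<open>A *v u = 0\<close>. Nonnegativity is asked for on this line because the eigenvector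
  construction knows it merely on a subspace.\<close>

lemma selfadj_null_vector:
  fixes A :: "'n::finite op"
  assumes A: "selfadj A"
    and nn: "\<And>r. 0 \<le> Re (cinner (u - r *\<^sub>R (A *v u)) (A *v (u - r *\<^sub>R (A *v u))))"
    and z: "Re (cinner u (A *v u)) = 0"
  shows "A *v u = 0"
proof (rule ccontr)
  assume "A *v u \<noteq> 0"
  define w where "w = A *v u"
  define q where "q = Re (cinner w (A *v w))"
  define N where "N = (norm w)\<^sup>2"
  have "N > 0" using \<open>A *v u \<noteq> 0\<close> by (simp add: N_def w_def)
  have 1: "0 \<le> - 2 * r * N + r\<^sup>2 * q" for r
  proof -
    have "cinner (u - r *\<^sub>R w) (A *v (u - r *\<^sub>R w)) =
      cinner u (A *v u) - of_real r * cinner w (A *v u) - of_real r * cinner u (A *v w)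
      + of_real (r\<^sup>2) * cinner w (A *v w)"
      by (simp add: matrix_vector_mult_diff_distrib cinner_diff_left cinner_diff_right matrix_vector_scaleR
          cinner_scaleR_left cinner_scaleR_right algebra_simps power2_eq_square)
    moreover have "cinner w (A *v u) = of_real N" "cinner u (A *v w) = of_real N"
      by (simp_all add: selfadj_cinner[OF A] flip: w_def) (simp_all add: cinner_self N_def w_def)
    ultimately show ?thesis
      using nn[of r] z by (simp add: w_def[symmetric] q_def power2_eq_square mult_ac)
  qed
  \<comment> \<open>The step size makes \<open>e * \<bar>q\<bar>\<close> smaller than
    \<open>N\<close>, so that the linear term wins; the summand 1 keeps the denominator positive
    when \<open>q = 0\<close>.\<close>
  define e where "e = N / (\<bar>q\<bar> + 1)"
  have e: "e > 0" "e * \<bar>q\<bar> < N * 1"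
    using \<open>N > 0\<close> by (auto simp: e_def field_simps)
  have "0 \<le> e * (- 2 * N + e * q)" using 1[of e] by (simp add: power2_eq_square algebra_simps)
  then have "0 \<le> - 2 * N + e * q" using e(1) by (simp add: zero_le_mult_iff)
  moreover have "e * q \<le> e * \<bar>q\<bar>" using e by (intro mult_left_mono) auto
  ultimately show False using e(2) \<open>N > 0\<close> by linarith
qed

lemma pos_op_null_vector: "pos_op A \<Longrightarrow> Re (cinner u (A *v u)) = 0 \<Longrightarrow> A *v u = 0"
  by (rule selfadj_null_vector) (auto simp: pos_op_selfadj pos_opD)

lemma pos_op_diag: "pos_op A \<Longrightarrow> nonneg_complex (A $ i $ i)"
  by (metis cinner_axis_mult_axis pos_op_def)

lemma pos_op_trace_nonneg: "pos_op A \<Longrightarrow> nonneg_complex (trace A)"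
  unfolding trace_def by (intro nonneg_complex_sum pos_op_diag)

text \<open>The diagonal entries are nonnegative with sum 0, so the form vanishes at every basis
  vector and \<open>A\<close> annihilates them all.\<close>

lemma pos_op_trace_0:
  fixes A :: "'n::finite op"
  assumes A: "pos_op A" and tr: "Re (trace A) = 0"
  shows "A = 0"
proof -
  have "\<forall>i\<in>UNIV. Re (A $ i $ i) = 0"
    using tr pos_op_diag[OF A]
    by (subst sum_nonneg_eq_0_iff[symmetric]) (auto simp: trace_def nonneg_complex_iff)
  then have z: "A *v axis i 1 = 0" for i
    using pos_op_null_vector[OF A, of "axis i 1"] by (simp add: cinner_axis_mult_axis)
  have "A $ i $ j = 0" for i j
    using cinner_axis_mult_axis[of i A j] by (simp add: z)
  then show ?thesis by (simp add: vec_eq_iff)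
qed

definition rank1 :: "complex^'n \<Rightarrow> 'n::finite op" where
  "rank1 w = (\<chi> i j. w $ i * cnj (w $ j))"

lemma rank1_vector: "rank1 w *v v = cinner w v *s w"
  by (simp add: rank1_def vec_eq_iff matrix_vector_mult_def cinner_def sum_distrib_left mult_ac)

lemma selfadj_rank1: "selfadj (rank1 w)"
  by (simp add: selfadj_def adj_def rank1_def mult.commute vec_eq_iff)

lemma cinner_rank1: "cinner v (rank1 w *v v) = cnj (cinner w v) * cinner w v"
  by (simp add: rank1_vector cinner_scale_right cinner_commute[of v w])

lemma pos_op_rank1: "pos_op (rank1 w)"
  unfolding pos_op_def cinner_rank1 using nonneg_complex_cnj_mult by blast

lemma trace_rank1: "trace (rank1 w) = cinner w w"
  by (simp add: trace_def rank1_def cinner_def mult.commute)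

lemma trace_mult_rank1: "trace (M ** rank1 w) = cinner w (M *v w)"
proof -
  have "trace (M ** rank1 w) = (\<Sum>i\<in>UNIV. \<Sum>j\<in>UNIV. M $ i $ j * (w $ j * cnj (w $ i)))"
    by (simp add: trace_def rank1_def matrix_matrix_mult_def)
  also have "\<dots> = cinner w (M *v w)" unfolding cinner_mult by (intro sum.cong refl) (simp add: mult_ac)
  finally show ?thesis .
qed

lemma rank1_mult: "rank1 u ** rank1 v = (\<chi> i j. cinner u v * u $ i * cnj (v $ j))"
  by (simp add: rank1_def matrix_matrix_mult_def cinner_def vec_eq_iff sum_distrib_left sum_distrib_right mult_ac)

section \<open>Spectral decomposition\<close>

text \<open>Induction over sets of indices. The orthogonal complement \<open>W\<close> of the
  eigenvectors found so far is invariant under \<open>A\<close>; the quadratic form attains its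
  maximum on the unit sphere of \<open>W\<close>, and a maximiser is the next eigenvector.\<close>

lemma orthonormal_eigenvectors:
  fixes A :: "'n::finite op" and S :: "'n set"
  assumes A: "selfadj A"
  shows "\<exists>u l. (\<forall>i\<in>S. \<forall>j\<in>S. cinner (u i) (u j) = (if i = j then 1 else 0)) \<and>
    (\<forall>i\<in>S. A *v u i = (l i :: real) *\<^sub>R u i)"
proof (induction S rule: finite_induct[OF finite])
  case 1
  then show ?case by auto
next
  case (2 k S)
  then obtain u and l :: "'n \<Rightarrow> real"
    where on: "\<And>i j. i \<in> S \<Longrightarrow> j \<in> S \<Longrightarrow> cinner (u i) (u j) = (if i = j then 1 else 0)"
      and ev: "\<And>i. i \<in> S \<Longrightarrow> A *v u i = l i *\<^sub>R u i"
    by blast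
  define W where "W = {v. \<forall>i\<in>S. cinner (u i) v = 0}"
  define P where "P = (\<Sum>i\<in>S. rank1 (u i))"
  \<comment> \<open>The trace counts the vectors. As the new index \<open>k\<close> is not in
    \<open>S\<close>, it differs from the dimension, so \<open>P\<close> is not the identity and
    some \<open>x - P *v x\<close> is a nonzero element of \<open>W\<close>.\<close>
  have "trace P = of_nat (card S)" by (simp add: P_def trace_sum trace_rank1 on)
  then have "trace P \<noteq> of_nat CARD('n)"
    using 2(2) by (metis of_nat_eq_iff card_subset_eq finite subset_UNIV UNIV_I)
  then have "P \<noteq> mat 1" by (auto simp: trace_I)
  then obtain x where x: "P *v x \<noteq> x"
    by (metis matrix_eq matrix_vector_mul_lid)
  define y where "y = x - P *v x"
  have "y \<noteq> 0" using x by (simp add: y_def)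
  have yW: "y \<in> W"
  proof -
    have "cinner (u i) (P *v x) = cinner (u i) x" if "i \<in> S" for i
    proof -
      have "cinner (u i) (P *v x) = (\<Sum>j\<in>S. cinner (u j) x * cinner (u i) (u j))"
        by (simp add: P_def sum_matrix_vector cinner_sum_right rank1_vector cinner_scale_right)
      also have "\<dots> = (\<Sum>j\<in>S. if j = i then cinner (u j) x else 0)"
        using that by (intro sum.cong refl) (auto simp: on)
      finally show ?thesis using that by simp
    qed
    then show ?thesis by (auto simp: W_def y_def cinner_diff_right)
  qed
  have W_scaleR: "r *\<^sub>R v \<in> W" and W_diff: "v - w \<in> W" if "v \<in> W" "w \<in> W" for r v w
    using that by (auto simp: W_def cinner_scaleR_right cinner_diff_right)
  have W_A: "A *v v \<in> W" if "v \<in> W" for v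
    using that by (auto simp: W_def selfadj_cinner[OF A] ev cinner_scaleR_left)
  have cont: "continuous_on X (\<lambda>v. cinner (f v) (g v))" 
    if "continuous_on X f" "continuous_on X g" for X :: "(complex^'n) set" and f g :: "_ \<Rightarrow> complex^'n"
    unfolding cinner_def using that by (intro continuous_intros)
  have contA: "continuous_on X (\<lambda>v. A *v v)" for X
    unfolding matrix_vector_mult_def by (intro continuous_intros)
  have "closed W"
  proof -
    have "W = (\<Inter>i\<in>S. {v. cinner (u i) v = 0})" by (auto simp: W_def)
    then show ?thesis by (auto intro!: closed_INT closed_Collect_eq cont continuous_intros)
  qed
  then have "compact (sphere 0 1 \<inter> W)" by (intro compact_Int_closed) auto
  moreover have "y /\<^sub>R norm y \<in> sphere 0 1 \<inter> W" using \<open>y \<noteq> 0\<close> yW W_scaleR by auto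
  moreover have "continuous_on (sphere 0 1 \<inter> W) (\<lambda>v. Re (cinner v (A *v v)))"
    by (intro continuous_intros cont contA)
  ultimately obtain e where e: "e \<in> sphere 0 1 \<inter> W"
    and max: "\<And>v. v \<in> sphere 0 1 \<inter> W \<Longrightarrow> Re (cinner v (A *v v)) \<le> Re (cinner e (A *v e))"
    using continuous_attains_sup by (metis (no_types, lifting) empty_iff)
  define m where "m = Re (cinner e (A *v e))"
  \<comment> \<open>Since \<open>m\<close> is the maximum, the form of \<open>T\<close> is
    nonnegative on \<open>W\<close> and vanishes at \<open>e\<close>. The null vector argument, run
    inside \<open>W\<close>, then gives \<open>T *v e = 0\<close>.\<close>
  define T where "T = m *\<^sub>R mat 1 - A"
  have T: "selfadj T" by (simp add: T_def A selfadj_diff selfadj_scaleR)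
  have Tv: "T *v v = m *\<^sub>R v - A *v v" for v
    by (simp add: T_def matrix_vector_mult_diff_rdistrib scaleR_matrix_vector)
  have Tq: "Re (cinner v (T *v v)) = m * (norm v)\<^sup>2 - Re (cinner v (A *v v))" for v
    by (simp add: Tv cinner_diff_right cinner_scaleR_right cinner_self)
  have Tpos: "0 \<le> Re (cinner v (T *v v))" if "v \<in> W" for v
  proof (cases "v = 0")
    case False
    have "Re (cinner (v /\<^sub>R norm v) (A *v (v /\<^sub>R norm v))) \<le> m"
      unfolding m_def using False that W_scaleR by (intro max) auto
    then have "Re (cinner v (A *v v)) / (norm v)\<^sup>2 \<le> m"
      by (simp add: matrix_vector_scaleR cinner_scaleR_left cinner_scaleR_right power2_eq_square field_simps)
    then show ?thesis using False by (simp add: Tq divide_le_eq)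
  qed simp
  have "T *v e = 0"
  proof (rule selfadj_null_vector[OF T])
    have "T *v e \<in> W" using e W_diff W_scaleR W_A by (auto simp: Tv)
    then show "0 \<le> Re (cinner (e - r *\<^sub>R (T *v e)) (T *v (e - r *\<^sub>R (T *v e))))" for r
      using e W_diff W_scaleR by (intro Tpos) auto
    show "Re (cinner e (T *v e)) = 0" using e by (simp add: Tq m_def)
  qed
  then have Ae: "A *v e = m *\<^sub>R e" by (simp add: Tv)
  have ee: "cinner e e = 1" using e by (simp add: cinner_self)
  have ue: "cinner (u i) e = 0" "cinner e (u i) = 0" if "i \<in> S" for i
    using e that cinner_commute[of e "u i"] by (auto simp: W_def)
  show ?case
    by (rule exI[of _ "u(k := e)"], rule exI[of _ "l(k := m)"]) (use 2(2) in \<open>auto simp: on ev Ae ee ue\<close>)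
qed

text \<open>For a full orthonormal family of eigenvectors the projection \<open>P\<close> onto its
  span has the trace of the identity. So \<open>mat 1 - P\<close> is positive of trace 0 and
  vanishes, and applying \<open>A\<close> to \<open>P *v v\<close> expands \<open>A\<close>.\<close>

lemma spectral_decomposition:
  fixes A :: "'n::finite op"
  assumes A: "selfadj A"
  obtains u :: "'n \<Rightarrow> complex^'n" and l :: "'n \<Rightarrow> real"
  where "\<And>i j. cinner (u i) (u j) = (if i = j then 1 else 0)"
    and "A = (\<Sum>i\<in>UNIV. l i *\<^sub>R rank1 (u i))"
    and "mat 1 = (\<Sum>i\<in>UNIV. rank1 (u i))"
proof -
  obtain u :: "'n \<Rightarrow> complex^'n" and l :: "'n \<Rightarrow> real"
    where on: "\<And>i j. cinner (u i) (u j) = (if i = j then 1 else 0)"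
      and ev: "\<And>i. A *v u i = l i *\<^sub>R u i"
    using orthonormal_eigenvectors[OF A, of UNIV] by auto
  define P where "P = (\<Sum>i\<in>UNIV. rank1 (u i))"
  have Pv: "P *v v = (\<Sum>i\<in>UNIV. cinner (u i) v *s u i)" for v
    by (simp add: P_def sum_matrix_vector rank1_vector)
  have Pu: "P *v u j = u j" for j
    by (simp add: Pv on vec_eq_iff if_distrib if_distribR cong: if_cong)
  have PP: "P *v (P *v v) = P *v v" for v
    by (subst (2 3) Pv) (simp add: matrix_vector_sum vector_scalar_commute Pu)
  have Q: "selfadj (mat 1 - P)"
    by (simp add: P_def selfadj_diff selfadj_sum selfadj_rank1)
  have QQ: "(mat 1 - P) *v ((mat 1 - P) *v v) = (mat 1 - P) *v v" for v
    by (simp add: matrix_vector_mult_diff_rdistrib matrix_vector_mult_diff_distrib PP)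
  have "pos_op (mat 1 - P)"
  proof (rule pos_opI[OF Q])
    show "0 \<le> Re (cinner v ((mat 1 - P) *v v))" for v
      by (subst QQ[symmetric], subst selfadj_cinner[OF Q]) (simp add: cinner_self)
  qed
  moreover have "trace (mat 1 - P) = 0"
    by (simp add: trace_sub trace_I P_def trace_sum trace_rank1 on)
  ultimately have P1: "mat 1 = P" using pos_op_trace_0 by fastforce
  moreover have "A = (\<Sum>i\<in>UNIV. l i *\<^sub>R rank1 (u i))"
  proof -
    have "A *v v = (\<Sum>i\<in>UNIV. l i *\<^sub>R rank1 (u i)) *v v" for v
    proof -
      have "A *v v = A *v (P *v v)" using P1 by (metis matrix_vector_mul_lid)
      also have "\<dots> = (\<Sum>i\<in>UNIV. l i *\<^sub>R rank1 (u i)) *v v"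
        unfolding Pv matrix_vector_sum vector_scalar_commute ev sum_matrix_vector scaleR_matrix_vector rank1_vector
        by (intro sum.cong refl) (simp add: vec_eq_iff)
      finally show ?thesis .
    qed
    then show ?thesis by (simp add: matrix_eq)
  qed
  ultimately show ?thesis
    by (intro that[OF on _ P1[unfolded P_def]])
qed

section \<open>Matrix algebra and the Hilbert-Schmidt inner product\<close>

lemma matrix_diff_ldistrib: "(A :: complex^'n^'m) ** (B - C) = A ** B - A ** C"
  by (simp add: matrix_matrix_mult_def vec_eq_iff right_diff_distrib sum_subtractf)

lemma matrix_diff_rdistrib: "(A - B :: complex^'n^'m) ** C = A ** C - B ** C"
  by (simp add: matrix_matrix_mult_def vec_eq_iff left_diff_distrib sum_subtractf)

lemma matrix_mul_sum: "(A :: complex^'n^'m) ** (\<Sum>i\<in>S. f i) = (\<Sum>i\<in>S. A ** f i)"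
  by (induction S rule: infinite_finite_induct)
    (auto simp: matrix_add_ldistrib matrix_matrix_mult_def vec_eq_iff distrib_left sum.distrib)

lemma sum_matrix_mul: "(\<Sum>i\<in>S. f i) ** (A :: complex^'n^'m) = (\<Sum>i\<in>S. f i ** A)"
  by (induction S rule: infinite_finite_induct)
    (auto simp: matrix_matrix_mult_def vec_eq_iff distrib_right sum.distrib)

lemma scaleR_matrix_mul: "(r *\<^sub>R A) ** (B :: complex^'n^'m) = r *\<^sub>R (A ** B)"
  by (simp add: matrix_matrix_mult_def vec_eq_iff scaleR_sum_right)

lemma matrix_mul_scaleR: "(A :: complex^'n^'m) ** (r *\<^sub>R B) = r *\<^sub>R (A ** B)"
  by (simp add: matrix_matrix_mult_def vec_eq_iff scaleR_sum_right)

text \<open>The Euclidean inner product on matrices is the real part of the Hilbert-Schmidt product.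
  This is what turns a separating hyperplane into a family of traces.\<close>

lemma inner_op: "X \<bullet> Y = Re (trace (adj X ** Y))" for X :: "'n::finite op"
proof -
  have "Re (trace (adj X ** Y)) = (\<Sum>j\<in>UNIV. \<Sum>i\<in>UNIV. X $ i $ j \<bullet> Y $ i $ j)"
    by (simp add: trace_def adj_def matrix_matrix_mult_def inner_complex_def)
  then show ?thesis by (subst (asm) sum.swap) (simp add: inner_vec_def)
qed

lemma pos_op_antisym: assumes "pos_op A" "pos_op (- A)" shows "A = 0"
  using assms pos_op_trace_nonneg[of A] pos_op_trace_nonneg[of "- A"]
  by (intro pos_op_trace_0) (auto simp: nonneg_complex_iff trace_def sum_negf)

lemma pos_op_congruence: "pos_op P \<Longrightarrow> pos_op (adj D ** P ** D)"
  by (simp add: pos_op_def cinner_adj[of _ "adj D"] flip: matrix_vector_mul_assoc)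

section \<open>Absolute value and trace norm\<close>

text \<open>For \<open>D = P - Q\<close> equal squares give \<open>P ** D + D ** Q = 0\<close>.
  Multiplying by \<open>D\<close> and taking traces leaves two nonnegative numbers with sum 0, so
  \<open>P\<close> and \<open>Q\<close> both annihilate the range of \<open>D\<close>. Hence
  \<open>D ** D = 0\<close>, and \<open>D = 0\<close> as \<open>D\<close> is selfadjoint. The
  uniqueness makes \<open>op_sqrt\<close> meaningful.\<close>

lemma pos_op_sqrt_unique:
  assumes P: "pos_op P" and Q: "pos_op Q" and eq: "P ** P = Q ** Q"
  shows "P = Q"
proof -
  define D where "D = P - Q"
  have D: "adj D = D"
    using P Q by (metis D_def pos_op_selfadj selfadj_def selfadj_diff)
  have "P ** D + D ** Q = 0"
    by (simp add: D_def matrix_diff_ldistrib matrix_diff_rdistrib eq)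
  then have "D ** (P ** D) + D ** (D ** Q) = 0"
    by (metis matrix_add_ldistrib matrix_diff_ldistrib diff_self)
  then have "trace (D ** (P ** D)) + trace (D ** (D ** Q)) = 0"
    by (metis trace_add trace_0 mat_0)
  then have "trace (adj D ** P ** D) + trace (adj D ** Q ** D) = 0"
    by (simp add: D matrix_mul_assoc trace_mul_sym[of "D ** D" Q]) (metis matrix_mul_assoc trace_mul_sym)
  then have "adj D ** P ** D = 0" "adj D ** Q ** D = 0"
    using pos_op_trace_nonneg[OF pos_op_congruence[OF P, of D]] pos_op_trace_nonneg[OF pos_op_congruence[OF Q, of D]]
    by (auto intro!: pos_op_trace_0 pos_op_congruence[OF P] pos_op_congruence[OF Q] simp: nonneg_complex_iff complex_eq_iff)
  then have "cinner (D *v v) (P *v (D *v v)) = 0" "cinner (D *v v) (Q *v (D *v v)) = 0" for v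
    by (simp_all add: D selfadj_def selfadj_cinner[of D, symmetric] matrix_vector_mul_assoc matrix_mul_assoc)
  then have "P *v (D *v v) = 0" "Q *v (D *v v) = 0" for v
    using pos_op_null_vector P Q by (metis zero_complex.simps(1))+
  then have "D *v (D *v v) = 0" for v
    by (subst D_def) (simp add: matrix_vector_mult_diff_rdistrib)
  then have "cinner (D *v v) (D *v v) = 0" for v
    by (simp add: D selfadj_def selfadj_cinner[of D, symmetric])
  then have "D *v v = 0" for v by (simp add: cinner_self)
  then have "D = 0" by (simp add: matrix_eq)
  then show ?thesis by (simp add: D_def)
qed

lemma op_abs_eqI: "pos_op P \<Longrightarrow> P ** P = adj K ** K \<Longrightarrow> op_abs K = P"
  unfolding op_abs_def op_sqrt_def by (rule the_equality) (auto intro: pos_op_sqrt_unique)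

text \<open>Functional calculus: operators diagonal in one orthonormal family multiply eigenvalue by
  eigenvalue, since distinct rank-one projections have product 0.\<close>

lemma rank1_spectral_mult:
  fixes u :: "'i::finite \<Rightarrow> complex^'n::finite"
  assumes on: "\<And>i j. cinner (u i) (u j) = (if i = j then 1 else 0)"
  shows "(\<Sum>i\<in>UNIV. a i *\<^sub>R rank1 (u i)) ** (\<Sum>j\<in>UNIV. b j *\<^sub>R rank1 (u j)) =
    (\<Sum>i\<in>UNIV. (a i * b i) *\<^sub>R rank1 (u i))"
proof -
  have "rank1 (u i) ** rank1 (u j) = (if i = j then rank1 (u i) else 0)" for i j
    unfolding rank1_mult by (simp add: on rank1_def vec_eq_iff)
  then have "(a i *\<^sub>R rank1 (u i)) ** (b j *\<^sub>R rank1 (u j)) =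
    (if i = j then (a i * b i) *\<^sub>R rank1 (u i) else 0)" for i j
    by (simp add: scaleR_matrix_mul matrix_mul_scaleR)
  note entry = this
  show ?thesis unfolding sum_matrix_mul matrix_mul_sum entry by simp
qed

lemma pos_op_spectral: "(\<And>i. 0 \<le> l i) \<Longrightarrow> pos_op (\<Sum>i\<in>UNIV. l i *\<^sub>R rank1 (u i))"
  by (intro pos_op_sum pos_op_scaleR pos_op_rank1)

lemma selfadj_spectral: "selfadj (\<Sum>i\<in>UNIV. l i *\<^sub>R rank1 (u i))"
  by (intro selfadj_sum selfadj_scaleR selfadj_rank1)

lemma op_abs_spectral:
  fixes u :: "'n::finite \<Rightarrow> complex^'n"
  assumes on: "\<And>i j. cinner (u i) (u j) = (if i = j then 1 else 0)"
  shows "op_abs (\<Sum>i\<in>UNIV. l i *\<^sub>R rank1 (u i)) = (\<Sum>i\<in>UNIV. \<bar>l i\<bar> *\<^sub>R rank1 (u i))"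
  using selfadj_spectral[of l u]
  by (intro op_abs_eqI pos_op_spectral) (auto simp: selfadj_def rank1_spectral_mult on)

lemma trace_spectral_mult:
  "Re (trace ((\<Sum>i\<in>UNIV. l i *\<^sub>R rank1 (u i)) ** X)) = (\<Sum>i\<in>UNIV. l i * Re (cinner (u i) (X *v u i)))"
  by (simp add: sum_matrix_mul scaleR_matrix_mul trace_sum trace_scaleR trace_mult_rank1 trace_mul_sym[of "rank1 _"])

lemma pos_op_abs: assumes "selfadj K" shows "pos_op (op_abs K)"
proof -
  obtain u :: "'a \<Rightarrow> complex^'a" and l where
    on: "\<And>i j. cinner (u i) (u j) = (if i = j then 1 else 0)" and K: "K = (\<Sum>i\<in>UNIV. l i *\<^sub>R rank1 (u i))"
    using spectral_decomposition[OF assms] by blast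
  show ?thesis by (simp add: K op_abs_spectral[OF on] pos_op_spectral)
qed

lemma op_abs_scaleR:
  assumes "selfadj K" "0 \<le> r" shows "op_abs (r *\<^sub>R K) = r *\<^sub>R op_abs K"
proof -
  obtain u :: "'a \<Rightarrow> complex^'a" and l where
    on: "\<And>i j. cinner (u i) (u j) = (if i = j then 1 else 0)" and K: "K = (\<Sum>i\<in>UNIV. l i *\<^sub>R rank1 (u i))"
    using spectral_decomposition[OF assms(1)] by blast
  show ?thesis using assms(2) op_abs_spectral[OF on, of "\<lambda>i. r * l i"]
    by (simp add: K op_abs_spectral[OF on] scaleR_sum_right abs_mult)
qed

lemma op_abs_mat_1: "op_abs (mat 1 :: 'n::finite op) = mat 1"
  by (intro op_abs_eqI pos_op_mat_1) (simp add: selfadj_mat_1[unfolded selfadj_def])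

lemma op_abs_trace_0:
  assumes "selfadj K" "Re (trace (op_abs K)) = 0" shows "K = 0"
proof -
  obtain u :: "'a \<Rightarrow> complex^'a" and l where
    on: "\<And>i j. cinner (u i) (u j) = (if i = j then 1 else 0)" and K: "K = (\<Sum>i\<in>UNIV. l i *\<^sub>R rank1 (u i))"
    using spectral_decomposition[OF assms(1)] by blast
  have "(\<Sum>i\<in>UNIV. \<bar>l i\<bar>) = 0"
    using assms(2) by (simp add: K op_abs_spectral[OF on] trace_sum trace_scaleR trace_rank1 on)
  then have "l i = 0" for i by (simp add: sum_nonneg_eq_0_iff)
  then show ?thesis by (simp add: K)
qed

text \<open>In an eigenbasis of \<open>K\<close> the trace is the sum of the eigenvalues weighted by
  the diagonal values of \<open>X\<close>, and these lie between \<open>- t\<close> and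
  \<open>t\<close>.\<close>

lemma trace_norm_upper:
  assumes "selfadj K" and X: "(- t) *\<^sub>R mat 1 \<preceq> X" "X \<preceq> t *\<^sub>R mat 1"
  shows "Re (trace (K ** X)) \<le> t * Re (trace (op_abs K))"
proof -
  obtain u :: "'a \<Rightarrow> complex^'a" and l where
    on: "\<And>i j. cinner (u i) (u j) = (if i = j then 1 else 0)" and K: "K = (\<Sum>i\<in>UNIV. l i *\<^sub>R rank1 (u i))"
    using spectral_decomposition[OF assms(1)] by blast
  have "l i * Re (cinner (u i) (X *v u i)) \<le> \<bar>l i\<bar> * t" for i
  proof -
    have "\<bar>Re (cinner (u i) (X *v u i))\<bar> \<le> t"
      using pos_opD[OF X(1)[unfolded loewner_le_def], of "u i"] pos_opD[OF X(2)[unfolded loewner_le_def], of "u i"]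
      by (simp add: matrix_vector_mult_diff_rdistrib matrix_vector_mult_add_rdistrib cinner_diff_right
          cinner_add_right scaleR_matrix_vector cinner_scaleR_right on)
    then show ?thesis
      using mult_left_mono[of "\<bar>Re (cinner (u i) (X *v u i))\<bar>" t "\<bar>l i\<bar>"]
        abs_ge_self[of "l i * Re (cinner (u i) (X *v u i))"]
      by (simp add: abs_mult)
  qed
  then show ?thesis
    by (simp add: K op_abs_spectral[OF on] trace_spectral_mult trace_sum trace_scaleR trace_rank1 on
        sum_distrib_left mult.commute[of t] sum_mono)
qed

lemma trace_norm_attained:
  fixes K :: "'n::finite op"
  assumes "selfadj K" "0 \<le> t"
  obtains R where "(- t) *\<^sub>R mat 1 \<preceq> R" "R \<preceq> t *\<^sub>R mat 1"
    "Re (trace (K ** R)) = t * Re (trace (op_abs K))"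
proof -
  obtain u :: "'n \<Rightarrow> complex^'n" and l where
    on: "\<And>i j. cinner (u i) (u j) = (if i = j then 1 else 0)" and K: "K = (\<Sum>i\<in>UNIV. l i *\<^sub>R rank1 (u i))"
    and I: "mat 1 = (\<Sum>i\<in>UNIV. rank1 (u i))"
    using spectral_decomposition[OF assms(1)] by blast
  \<comment> \<open>\<open>R\<close> is \<open>t\<close> times the sign of \<open>K\<close>, the
    extremal operator for the trace norm. On the kernel of \<open>K\<close> it is 0, which stays
    within the bounds.\<close>
  define R where "R = (\<Sum>i\<in>UNIV. (t * sgn (l i)) *\<^sub>R rank1 (u i))"
  have "R - (- t) *\<^sub>R mat 1 = (\<Sum>i\<in>UNIV. (t * (sgn (l i) + 1)) *\<^sub>R rank1 (u i))"
    "t *\<^sub>R mat 1 - R = (\<Sum>i\<in>UNIV. (t * (1 - sgn (l i))) *\<^sub>R rank1 (u i))"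
    by (simp_all add: R_def I scaleR_sum_right algebra_simps flip: sum.distrib sum_subtractf)
  moreover have "pos_op (\<Sum>i\<in>UNIV. (t * (sgn (l i) + 1)) *\<^sub>R rank1 (u i))"
     "pos_op (\<Sum>i\<in>UNIV. (t * (1 - sgn (l i))) *\<^sub>R rank1 (u i))"
    using assms(2) by (intro pos_op_spectral mult_nonneg_nonneg; simp add: sgn_if)+
  moreover have "Re (trace (K ** R)) = t * Re (trace (op_abs K))"
    by (simp add: K R_def rank1_spectral_mult[OF on] op_abs_spectral[OF on] trace_sum trace_scaleR trace_rank1 on
        sum_distrib_left mult.left_commute linordered_idom_class.mult_sgn_abs abs_sgn)
  ultimately show ?thesis by (intro that[of R]) (simp_all add: loewner_le_def)
qed

section \<open>The positive cone: self-duality, closedness and compactness\<close>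

lemma pos_op_rank1_sum:
  fixes C :: "'n::finite op"
  assumes "pos_op C"
  obtains w :: "'n \<Rightarrow> complex^'n" where "C = (\<Sum>i\<in>UNIV. rank1 (w i))"
proof -
  obtain u :: "'n \<Rightarrow> complex^'n" and l where
    on: "\<And>i j. cinner (u i) (u j) = (if i = j then 1 else 0)" and C: "C = (\<Sum>i\<in>UNIV. l i *\<^sub>R rank1 (u i))"
    using spectral_decomposition[OF pos_op_selfadj[OF assms]] by blast
  have "cinner (u j) (C *v u j) = l j" for j
    by (simp add: C sum_matrix_vector cinner_sum_right scaleR_matrix_vector cinner_scaleR_right cinner_rank1 on
       if_distrib cong: if_cong)
  then have "0 \<le> l j" for j using pos_opD[OF assms, of "u j"] by simp
  then have "l j *\<^sub>R rank1 (u j) = rank1 (sqrt (l j) *\<^sub>R u j)" for j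
    by (simp add: rank1_def vec_eq_iff)
  then show ?thesis using C that by simp
qed

text \<open>With \<open>C\<close> written as a sum of rank-one operators, the trace becomes a sum of
  values of the quadratic form of \<open>M\<close>. Weak duality rests on this.\<close>

lemma trace_mult_pos_op: "pos_op C \<Longrightarrow> pos_op M \<Longrightarrow> 0 \<le> Re (trace (C ** M))"
  by (elim pos_op_rank1_sum[of C])
    (simp add: sum_matrix_mul trace_sum trace_mult_rank1 trace_mul_sym[of "rank1 _"] sum_nonneg pos_opD)

lemma norm_rank1: "norm (rank1 w) = (norm w)\<^sup>2"
proof -
  have "(norm (rank1 w))\<^sup>2 = ((norm w)\<^sup>2)\<^sup>2"
  proof -
    have "(norm (rank1 w))\<^sup>2 = Re (trace (rank1 w ** rank1 w))"
      unfolding power2_norm_eq_inner inner_op selfadj_rank1[unfolded selfadj_def] ..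
    also have "\<dots> = ((norm w)\<^sup>2)\<^sup>2"
      unfolding trace_mult_rank1 cinner_rank1 cinner_self by (simp add: power2_eq_square)
    finally show ?thesis .
  qed
  then show ?thesis by (metis power2_eq_imp_eq norm_ge_zero zero_le_power2)
qed

text \<open>Triangle inequality over the rank-one summands, for which norm and trace agree. A bound
  on the trace thus bounds positive operators, which is the source of compactness below.\<close>

lemma norm_pos_op_le_trace:
  fixes C :: "'n::finite op"
  assumes "pos_op C" shows "norm C \<le> Re (trace C)"
proof -
  obtain w :: "'n \<Rightarrow> complex^'n" where C: "C = (\<Sum>i\<in>UNIV. rank1 (w i))"
    using pos_op_rank1_sum[OF assms] by blast
  have "norm C \<le> (\<Sum>i\<in>UNIV. norm (rank1 (w i)))" unfolding C by (rule norm_sum)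
  also have "\<dots> = Re (trace C)" by (simp add: C trace_sum trace_rank1 cinner_self norm_rank1)
  finally show ?thesis .
qed

lemma closed_pos_op: "closed {A :: 'n::finite op. pos_op A}"
proof -
  have "{A :: 'n op. pos_op A} = (\<Inter>v. {A. Im (cinner v (A *v v)) = 0} \<inter> {A. 0 \<le> Re (cinner v (A *v v))})"
    by (auto simp: pos_op_def nonneg_complex_iff)
  also have "closed \<dots>"
  proof -
    have "continuous_on UNIV (\<lambda>A :: 'n op. cinner v (A *v v))" for v
      unfolding cinner_mult by (intro continuous_intros)
    then show ?thesis
      by (intro closed_INT ballI closed_Int closed_Collect_eq closed_Collect_le continuous_on_Re continuous_on_Im
          continuous_on_const)
  qed
  finally show ?thesis .
qed

lemma compact_pos_op: "compact {A :: 'n::finite op. pos_op A \<and> Re (trace A) \<le> N}"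
proof -
  have "{A :: 'n op. pos_op A \<and> Re (trace A) \<le> N} = {A. pos_op A} \<inter> {A. Re (trace A) \<le> N}" by auto
  moreover have "closed {A :: 'n op. Re (trace A) \<le> N}"
    unfolding trace_def by (intro closed_Collect_le continuous_intros)
  moreover have "bounded {A :: 'n op. pos_op A \<and> Re (trace A) \<le> N}"
    unfolding bounded_iff using norm_pos_op_le_trace by (intro exI[of _ N]) fastforce
  ultimately show ?thesis using closed_pos_op by (metis compact_eq_bounded_closed closed_Int)
qed

lemma convex_pos_op: "convex {A :: 'n::finite op. pos_op A}"
  by (auto simp: convex_def intro!: pos_op_add pos_op_scaleR)

section \<open>Choi operators\<close>

lemma sum_UNIV_prod: "(\<Sum>p\<in>UNIV. f p) = (\<Sum>a\<in>UNIV. \<Sum>b\<in>UNIV. f (a, b))"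
  by (simp add: sum.cartesian_product flip: UNIV_Times_UNIV)

lemma mat_mult_nth: "(mat c ** X) $ i $ j = c * X $ i $ j" for X :: "complex^'n^'n"
  by (simp add: matrix_matrix_mult_def mat_def if_distrib if_distribR cong: if_cong)

lemma trace_mult: "trace (A ** B) = (\<Sum>i\<in>UNIV. \<Sum>j\<in>UNIV. A $ i $ j * B $ j $ i)"
  by (simp add: trace_def matrix_matrix_mult_def)

text \<open>The trace pairing is nondegenerate: testing with the adjoint of \<open>M - N\<close>
  gives its squared norm. Hence a trace adjoint is unique, as the description in
  \<open>tr_adjoint\<close> requires.\<close>

lemma trace_eqI:
  fixes M N :: "'n::finite op"
  assumes "\<And>Y. trace (M ** Y) = trace (N ** Y)" shows "M = N"
proof -
  have "trace (adj (adj (M - N)) ** adj (M - N)) = 0"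
    using assms[of "adj (M - N)"] by (simp add: matrix_diff_rdistrib trace_sub)
  then have "adj (M - N) \<bullet> adj (M - N) = 0" by (simp only: inner_op) simp
  then have "adj (adj (M - N)) = 0" by simp
  then show ?thesis by simp
qed

lemma tr_adjoint_eqI:
  assumes "\<And>X Y. trace (X ** \<Phi> Y) = trace (\<Psi> X ** Y)"
  shows "tr_adjoint \<Phi> = \<Psi>"
  unfolding tr_adjoint_def
proof (rule the_equality)
  fix \<Psi>' assume "\<forall>X Y. trace (X ** \<Phi> Y) = trace (\<Psi>' X ** Y)"
  then show "\<Psi>' = \<Psi>" using assms by (intro ext trace_eqI) metis
qed (use assms in blast)

text \<open>
  The entries are arranged so that \<open>choi_dual C X\<close>, the trace adjoint of \<open>choi_map C\<close>, is the partial trace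
  over the second factor of \<open>C ** (mat 1 \<otimes>\<^sub>o transpose X)\<close>.
\<close>

definition choi_map :: "('n \<times> 'n) op \<Rightarrow> 'n op \<Rightarrow> 'n::finite op" where
  "choi_map C Y = (\<chi> j i. \<Sum>k\<in>UNIV. \<Sum>l\<in>UNIV. Y $ k $ l * C $ (l, i) $ (k, j))"

definition choi_dual :: "('n \<times> 'n) op \<Rightarrow> 'n op \<Rightarrow> 'n::finite op" where
  "choi_dual C X = (\<chi> l k. \<Sum>i\<in>UNIV. \<Sum>j\<in>UNIV. C $ (l, i) $ (k, j) * X $ i $ j)"

text \<open>This moves a pairing with the adjoint map onto the Choi operator, and it is where the
  tensor products and the transpose of the dual constraint come from. The proof only reorders
  sums.\<close>

lemma trace_choi_dual: "trace (H ** choi_dual C X) = trace (C ** (H \<otimes>\<^sub>o transpose X))"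
proof -
  let ?f = "\<lambda>k l i j. C $ (l, i) $ (k, j) * (H $ k $ l * X $ i $ j)"
  have "trace (H ** choi_dual C X) = (\<Sum>k\<in>UNIV. \<Sum>l\<in>UNIV. \<Sum>i\<in>UNIV. \<Sum>j\<in>UNIV. ?f k l i j)"
    by (simp add: trace_mult choi_dual_def sum_distrib_left mult_ac)
  also have "\<dots> = (\<Sum>l\<in>UNIV. \<Sum>k\<in>UNIV. \<Sum>i\<in>UNIV. \<Sum>j\<in>UNIV. ?f k l i j)"
    by (rule sum.swap)
  also have "\<dots> = (\<Sum>l\<in>UNIV. \<Sum>i\<in>UNIV. \<Sum>k\<in>UNIV. \<Sum>j\<in>UNIV. ?f k l i j)"
    by (intro sum.cong refl sum.swap)
  also have "\<dots> = trace (C ** (H \<otimes>\<^sub>o transpose X))"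
    by (simp add: trace_mult sum_UNIV_prod tensor_op_def transpose_def)
  finally show ?thesis .
qed

lemma tr_adjoint_choi_map_eq: "trace (X ** choi_map C Y) = trace (choi_dual C X ** Y)"
proof -
  let ?f = "\<lambda>i j k l. X $ i $ j * (Y $ k $ l * C $ (l, i) $ (k, j))"
  have "trace (X ** choi_map C Y) = (\<Sum>i\<in>UNIV. \<Sum>j\<in>UNIV. \<Sum>k\<in>UNIV. \<Sum>l\<in>UNIV. ?f i j k l)"
    by (simp add: trace_mult choi_map_def sum_distrib_left)
  also have "\<dots> = (\<Sum>i\<in>UNIV. \<Sum>k\<in>UNIV. \<Sum>j\<in>UNIV. \<Sum>l\<in>UNIV. ?f i j k l)"
    by (intro sum.cong refl sum.swap)
  also have "\<dots> = (\<Sum>k\<in>UNIV. \<Sum>i\<in>UNIV. \<Sum>j\<in>UNIV. \<Sum>l\<in>UNIV. ?f i j k l)"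
    by (rule sum.swap)
  also have "\<dots> = (\<Sum>k\<in>UNIV. \<Sum>i\<in>UNIV. \<Sum>l\<in>UNIV. \<Sum>j\<in>UNIV. ?f i j k l)"
    by (intro sum.cong refl sum.swap)
  also have "\<dots> = (\<Sum>k\<in>UNIV. \<Sum>l\<in>UNIV. \<Sum>i\<in>UNIV. \<Sum>j\<in>UNIV. ?f i j k l)"
    by (intro sum.cong refl sum.swap)
  also have "\<dots> = (\<Sum>l\<in>UNIV. \<Sum>k\<in>UNIV. \<Sum>i\<in>UNIV. \<Sum>j\<in>UNIV. ?f i j k l)"
    by (rule sum.swap)
  also have "\<dots> = trace (choi_dual C X ** Y)"
    by (simp add: trace_mult choi_dual_def sum_distrib_left sum_distrib_right mult_ac)
  finally show ?thesis .
qed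

lemma tr_adjoint_choi_map: "tr_adjoint (choi_map C) = choi_dual C"
  by (intro tr_adjoint_eqI tr_adjoint_choi_map_eq)

lemma choi_map_sum: "choi_map (\<Sum>m\<in>S. C m) Y = (\<Sum>m\<in>S. choi_map (C m) Y)"
  by (induction S rule: infinite_finite_induct)
    (auto simp: choi_map_def vec_eq_iff distrib_left sum.distrib)

text \<open>A rank-one Choi operator has a single Kraus operator \<open>V\<close>, the vector
  \<open>w\<close> reshaped into a matrix and conjugated.\<close>

lemma choi_map_rank1:
  fixes w :: "complex^('n::finite \<times> 'n)"
  defines "V \<equiv> \<chi> j k. cnj (w $ (k, j))"
  shows "choi_map (rank1 w) Y = V ** Y ** adj V"
  unfolding V_def
  by (simp add: choi_map_def rank1_def adj_def matrix_matrix_mult_def vec_eq_iff sum_distrib_right sum_distrib_left mult_ac)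
    (intro allI sum.swap)

lemma clinear_choi_map: "clinear_map (choi_map C)"
  by (simp add: clinear_map_def choi_map_def vec_eq_iff mat_mult_nth distrib_right sum.distrib sum_distrib_left mult.assoc)

text \<open>A rank-one expansion of \<open>C\<close> gives a Kraus form of the map. Each Kraus
  operator is absorbed into the test vectors, \<open>v i\<close> becoming
  \<open>adj (V m) *v v i\<close>, and this preserves block positivity.\<close>

lemma completely_positive_choi_map:
  fixes C :: "('n::finite \<times> 'n) op"
  assumes "pos_op C" shows "completely_positive (choi_map C)"
proof -
  obtain w :: "'n \<times> 'n \<Rightarrow> complex^('n \<times> 'n)" where C: "C = (\<Sum>m\<in>UNIV. rank1 (w m))"
    using pos_op_rank1_sum[OF assms] by blast
  define V where "V = (\<lambda>m. \<chi> j k. cnj (w m $ (k, j)))"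
  have kraus: "choi_map C Y = (\<Sum>m\<in>UNIV. V m ** Y ** adj (V m))" for Y
    by (simp add: C choi_map_sum choi_map_rank1 V_def)
  have "block_pos k (\<lambda>i j. choi_map C (X i j))" if X: "block_pos k X" for k X
    unfolding block_pos_def
  proof
    fix v :: "nat \<Rightarrow> complex^'n"
    have "(\<Sum>i<k. \<Sum>j<k. cinner (v i) (choi_map C (X i j) *v v j)) =
      (\<Sum>i<k. \<Sum>j<k. \<Sum>m\<in>UNIV. cinner (adj (V m) *v v i) (X i j *v (adj (V m) *v v j)))"
      by (simp add: kraus sum_matrix_vector cinner_sum_right cinner_adj[of _ "V _"] flip: matrix_vector_mul_assoc)
    also have "\<dots> = (\<Sum>i<k. \<Sum>m\<in>UNIV. \<Sum>j<k. cinner (adj (V m) *v v i) (X i j *v (adj (V m) *v v j)))"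
      by (intro sum.cong refl sum.swap)
    also have "\<dots> = (\<Sum>m\<in>UNIV. \<Sum>i<k. \<Sum>j<k. cinner (adj (V m) *v v i) (X i j *v (adj (V m) *v v j)))"
      by (rule sum.swap)
    also have "nonneg_complex \<dots>"
      by (rule nonneg_complex_sum) (rule X[unfolded block_pos_def, rule_format])
    finally show "nonneg_complex (\<Sum>i<k. \<Sum>j<k. cinner (v i) (choi_map C (X i j) *v v j))" .
  qed
  then show ?thesis by (simp add: completely_positive_def clinear_choi_map)
qed

section \<open>Choi operators of completely positive maps\<close>

definition matrix_unit :: "'n \<Rightarrow> 'n \<Rightarrow> 'n::finite op" where
  "matrix_unit k l = (\<chi> i j. if i = k \<and> j = l then 1 else 0)"

lemma matrix_unit_expansion: "Y = (\<Sum>k\<in>UNIV. \<Sum>l\<in>UNIV. mat (Y $ k $ l) ** matrix_unit k l)"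
proof -
  have "(\<Sum>k\<in>UNIV. \<Sum>l\<in>UNIV. (if i = k \<and> j = l then Y $ k $ l else 0)) = Y $ i $ j" for i j
  proof -
    have "(\<Sum>k\<in>UNIV. \<Sum>l\<in>UNIV. (if i = k \<and> j = l then Y $ k $ l else 0)) =
      (\<Sum>k\<in>UNIV. if i = k then Y $ k $ j else 0)"
      by (intro sum.cong refl) auto
    then show ?thesis by simp
  qed
  then show ?thesis
    by (simp add: vec_eq_iff mat_mult_nth matrix_unit_def if_distrib cong: if_cong)
qed

lemma clinear_map_sum:
  fixes \<Phi> :: "'n::finite op \<Rightarrow> 'n op"
  assumes "clinear_map \<Phi>" shows "\<Phi> (\<Sum>i\<in>S. f i) = (\<Sum>i\<in>S. \<Phi> (f i))"
proof -
  have "\<Phi> (mat 0 ** 0) = mat 0 ** \<Phi> 0" using assms unfolding clinear_map_def by blast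
  moreover have "mat 0 ** X = 0" for X :: "complex^'n^'n" by (simp add: vec_eq_iff mat_mult_nth)
  ultimately have "\<Phi> 0 = 0" by simp
  then show ?thesis
    using assms by (induction S rule: infinite_finite_induct) (auto simp: clinear_map_def)
qed

lemma cinner_matrix_unit: "cinner v (matrix_unit k l *v w) = cnj (v $ k) * w $ l"
proof -
  have "matrix_unit k l *v w = w $ l *s axis k 1"
    by (auto simp: vec_eq_iff matrix_vector_mult_def matrix_unit_def axis_def if_distrib if_distribR cong: if_cong)
  then show ?thesis
    by (simp add: cinner_scale_right cinner_commute[of v] cinner_axis)
qed

text \<open>Choi's theorem: the block operator whose blocks are all the matrix units is positive,
  and its image under \<Phi> is \<open>C\<close> up to a rearrangement of indices.\<close>

lemma completely_positive_imp_choi_map: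
  fixes \<Phi> :: "'n::finite op \<Rightarrow> 'n op"
  assumes "completely_positive \<Phi>"
  obtains C where "pos_op C" "\<Phi> = choi_map C"
proof -
  have lin: "clinear_map \<Phi>"
    and cp: "\<And>k X. block_pos k X \<Longrightarrow> block_pos k (\<lambda>i j. \<Phi> (X i j))"
    using assms by (auto simp: completely_positive_def)
  define C :: "('n \<times> 'n) op" where "C = (\<chi> p q. \<Phi> (matrix_unit (fst q) (fst p)) $ snd q $ snd p)"
  have "\<Phi> Y = choi_map C Y" for Y
  proof -
    have "\<Phi> Y = (\<Sum>k\<in>UNIV. \<Sum>l\<in>UNIV. mat (Y $ k $ l) ** \<Phi> (matrix_unit k l))"
      by (subst matrix_unit_expansion[of Y])
        (use lin in \<open>simp add: clinear_map_sum[OF lin] clinear_map_def\<close>)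
    then show ?thesis by (simp add: choi_map_def C_def vec_eq_iff mat_mult_nth)
  qed
  moreover have "pos_op C"
    unfolding pos_op_def
  proof
    fix v :: "complex^('n \<times> 'n)"
    \<comment> \<open>Blocks are indexed by natural numbers, so the index type has to be
      enumerated.\<close>
    obtain f where f: "bij_betw f {..<CARD('n)} (UNIV :: 'n set)"
      using ex_bij_betw_nat_finite[OF finite[of UNIV]] by (auto simp: atLeast0LessThan)
    \<comment> \<open>\<open>C\<close> holds the blocks in transposed order, so its form at
      \<open>v\<close> is the block form at the conjugated components of \<open>v\<close>.\<close>
    define u :: "'n \<Rightarrow> complex^'n" where "u = (\<lambda>k. \<chi> j. cnj (v $ (k, j)))"
    \<comment> \<open>At any test vectors this block form is a single number times its own
      conjugate.\<close>
    have "block_pos CARD('n) (\<lambda>a b. matrix_unit (f a) (f b))"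
      unfolding block_pos_def cinner_matrix_unit sum_distrib_left[symmetric] sum_distrib_right[symmetric] cnj_sum[symmetric]
      using nonneg_complex_cnj_mult by blast
    then have "nonneg_complex (\<Sum>a<CARD('n). \<Sum>b<CARD('n). cinner (u (f a)) (\<Phi> (matrix_unit (f a) (f b)) *v u (f b)))"
      using cp[of "CARD('n)" "\<lambda>a b. matrix_unit (f a) (f b)"] by (simp add: block_pos_def)
    also have "(\<Sum>a<CARD('n). \<Sum>b<CARD('n). cinner (u (f a)) (\<Phi> (matrix_unit (f a) (f b)) *v u (f b))) =
      (\<Sum>k\<in>UNIV. \<Sum>l\<in>UNIV. cinner (u k) (\<Phi> (matrix_unit k l) *v u l))"
      by (simp add: sum.reindex_bij_betw[OF f, of "\<lambda>l. cinner (u _) (\<Phi> (matrix_unit _ l) *v u l)"]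
        sum.reindex_bij_betw[OF f, of "\<lambda>k. \<Sum>l\<in>UNIV. cinner (u k) (\<Phi> (matrix_unit k l) *v u l)"])
    also have "\<dots> = cinner v (C *v v)"
    proof -
      let ?g = "\<lambda>k l j i. v $ (k, j) * \<Phi> (matrix_unit k l) $ j $ i * cnj (v $ (l, i))"
      have "(\<Sum>k\<in>UNIV. \<Sum>l\<in>UNIV. cinner (u k) (\<Phi> (matrix_unit k l) *v u l)) =
        (\<Sum>k\<in>UNIV. \<Sum>l\<in>UNIV. \<Sum>j\<in>UNIV. \<Sum>i\<in>UNIV. ?g k l j i)"
        by (simp add: cinner_mult u_def)
      also have "\<dots> = (\<Sum>l\<in>UNIV. \<Sum>k\<in>UNIV. \<Sum>j\<in>UNIV. \<Sum>i\<in>UNIV. ?g k l j i)"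
        by (rule sum.swap)
      also have "\<dots> = (\<Sum>l\<in>UNIV. \<Sum>k\<in>UNIV. \<Sum>i\<in>UNIV. \<Sum>j\<in>UNIV. ?g k l j i)"
        by (intro sum.cong refl sum.swap)
      also have "\<dots> = (\<Sum>l\<in>UNIV. \<Sum>i\<in>UNIV. \<Sum>k\<in>UNIV. \<Sum>j\<in>UNIV. ?g k l j i)"
        by (intro sum.cong refl sum.swap)
      also have "\<dots> = cinner v (C *v v)"
        by (simp add: cinner_mult sum_UNIV_prod C_def mult_ac)
      finally show ?thesis .
    qed
    finally show "nonneg_complex (cinner v (C *v v))" .
  qed
  ultimately show ?thesis using that by blast
qed

lemma tr_adjoint_total_choi_map:
  "tr_adjoint (total_map (\<lambda>x. choi_map (C x))) = (\<lambda>X. \<Sum>x\<in>UNIV. choi_dual (C x) X)"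
  by (intro tr_adjoint_eqI)
    (simp add: total_map_def matrix_mul_sum sum_matrix_mul trace_sum tr_adjoint_choi_map_eq)

text \<open>From here on an instrument is a family of positive operators under a linear constraint,
  so that compactness and separation arguments in finite dimension apply.\<close>

lemma implements_iff_choi:
  "implements \<I> A \<longleftrightarrow>
    (\<exists>C. (\<forall>x. pos_op (C x) \<and> choi_dual (C x) (mat 1) = A x) \<and> \<I> = (\<lambda>x. choi_map (C x)))"
proof
  assume I: "implements \<I> A"
  then have "\<forall>x. \<exists>C. pos_op C \<and> \<I> x = choi_map C"
    unfolding implements_def using completely_positive_imp_choi_map by metis
  then obtain C where C: "\<And>x. pos_op (C x)" "\<And>x. \<I> x = choi_map (C x)" by metis
  moreover have "choi_dual (C x) (mat 1) = A x" for x
    using I by (simp add: implements_def C tr_adjoint_choi_map)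
  ultimately show "\<exists>C. (\<forall>x. pos_op (C x) \<and> choi_dual (C x) (mat 1) = A x) \<and> \<I> = (\<lambda>x. choi_map (C x))"
    by blast
next
  assume "\<exists>C. (\<forall>x. pos_op (C x) \<and> choi_dual (C x) (mat 1) = A x) \<and> \<I> = (\<lambda>x. choi_map (C x))"
  then show "implements \<I> A"
    by (auto simp: implements_def tr_adjoint_choi_map completely_positive_choi_map)
qed

lemma disturbance_set_choi:
  "disturbance_set A B = {t. 0 \<le> t \<and> t \<le> 1 \<and>
     (\<exists>C. (\<forall>x. pos_op (C x) \<and> choi_dual (C x) (mat 1) = A x) \<and>
        (\<forall>y. (- t) *\<^sub>R mat 1 \<preceq> B y - (\<Sum>x\<in>UNIV. choi_dual (C x) (B y)) \<and>
             B y - (\<Sum>x\<in>UNIV. choi_dual (C x) (B y)) \<preceq> t *\<^sub>R mat 1))}"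
  unfolding disturbance_set_def implements_iff_choi
  by (auto simp: tr_adjoint_total_choi_map; metis tr_adjoint_total_choi_map)

lemma measurable_iff_choi:
  "measurable_without_disturbing A B \<longleftrightarrow>
     (\<exists>C. (\<forall>x. pos_op (C x) \<and> choi_dual (C x) (mat 1) = A x) \<and>
        (\<forall>y. (\<Sum>x\<in>UNIV. choi_dual (C x) (B y)) = B y))"
  unfolding measurable_without_disturbing_def implements_iff_choi
  by (auto simp: tr_adjoint_total_choi_map; metis tr_adjoint_total_choi_map)

section \<open>Tensor products and the trivial instrument\<close>

lemma tensor_scaleR_left: "(r *\<^sub>R A) \<otimes>\<^sub>o C = r *\<^sub>R (A \<otimes>\<^sub>o C)"
  and tensor_0_left [simp]: "0 \<otimes>\<^sub>o C = 0"
  by (simp_all add: tensor_op_def vec_eq_iff)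

lemma tensor_add_right: "A \<otimes>\<^sub>o (B + C) = A \<otimes>\<^sub>o B + A \<otimes>\<^sub>o C"
  and tensor_0_right [simp]: "A \<otimes>\<^sub>o 0 = 0"
  by (simp_all add: tensor_op_def vec_eq_iff distrib_left)

lemma tensor_mat_1: "mat 1 \<otimes>\<^sub>o mat 1 = mat 1"
  by (auto simp: tensor_op_def vec_eq_iff mat_def prod_eq_iff)

lemma tensor_sum_right: "A \<otimes>\<^sub>o (\<Sum>i\<in>S. f i) = (\<Sum>i\<in>S. A \<otimes>\<^sub>o f i)"
  by (induction S rule: infinite_finite_induct) (auto simp: tensor_add_right)

lemma transpose_sum: "transpose (\<Sum>i\<in>S. f i) = (\<Sum>i\<in>S. transpose (f i :: complex^'n^'m))"
  by (induction S rule: infinite_finite_induct) (auto simp: transpose_def vec_eq_iff)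

lemma selfadj_nth: "selfadj A \<Longrightarrow> cnj (A $ i $ j) = A $ j $ i"
  by (simp add: selfadj_def adj_def vec_eq_iff)

lemma selfadj_transpose: "selfadj A \<Longrightarrow> selfadj (transpose A)"
  unfolding selfadj_def[of "transpose A"] by (simp add: adj_def transpose_def vec_eq_iff selfadj_nth)

lemma selfadj_tensor: "selfadj A \<Longrightarrow> selfadj B \<Longrightarrow> selfadj (A \<otimes>\<^sub>o B)"
  unfolding selfadj_def[of "A \<otimes>\<^sub>o B"] by (simp add: adj_def tensor_op_def vec_eq_iff selfadj_nth)

lemma selfadj_choi_dual: "selfadj C \<Longrightarrow> selfadj X \<Longrightarrow> selfadj (choi_dual C X)"
  unfolding selfadj_def[of "choi_dual C X"]
  by (simp add: adj_def choi_dual_def vec_eq_iff selfadj_nth) (intro allI sum.swap)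

lemma choi_dual_add: "choi_dual (C + D) X = choi_dual C X + choi_dual D X"
  and choi_dual_scaleR: "choi_dual (r *\<^sub>R C) X = r *\<^sub>R choi_dual C X"
  by (simp_all add: choi_dual_def vec_eq_iff distrib_right sum.distrib scaleR_sum_right)

lemma trace_choi: "trace (choi_dual C (mat 1)) = trace C"
  using trace_choi_dual[of "mat 1" C "mat 1"] by (simp add: transpose_mat tensor_mat_1)

lemma continuous_on_choi_dual:
  "continuous_on S f \<Longrightarrow> continuous_on S (\<lambda>p. choi_dual (f p) X)"
  unfolding choi_dual_def by (intro continuous_intros)

lemma choi_dual_tensor_mat_1: "choi_dual (A \<otimes>\<^sub>o mat 1) X = mat (trace X) ** A"
proof -
  have "choi_dual (A \<otimes>\<^sub>o mat 1) X $ l $ k = A $ l $ k * trace X" for l k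
    by (simp add: choi_dual_def tensor_op_def mat_def trace_def sum_distrib_left if_distrib if_distribR cong: if_cong)
  then show ?thesis by (simp add: vec_eq_iff mat_mult_nth)
qed

text \<open>The operator is block diagonal in the second index, so its form is a sum of values of
  the form of \<open>A\<close>.\<close>

lemma pos_op_tensor_mat_1:
  assumes "pos_op A" shows "pos_op (A \<otimes>\<^sub>o mat 1)"
  unfolding pos_op_def
proof
  fix v :: "complex^('a \<times> 'b)"
  have "cinner v ((A \<otimes>\<^sub>o mat 1) *v v) =
    (\<Sum>a\<in>UNIV. \<Sum>i\<in>UNIV. \<Sum>b\<in>UNIV. cnj (v $ (a, i)) * A $ a $ b * v $ (b, i))"
    by (simp add: cinner_mult sum_UNIV_prod tensor_op_def mat_def if_distrib if_distribR cong: if_cong)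
  also have "\<dots> = (\<Sum>i\<in>UNIV. cinner (\<chi> a. v $ (a, i)) (A *v (\<chi> a. v $ (a, i))))"
    by (subst sum.swap) (simp add: cinner_mult)
  also have "nonneg_complex \<dots>" using assms by (intro nonneg_complex_sum) (simp add: pos_op_def)
  finally show "nonneg_complex (cinner v ((A \<otimes>\<^sub>o mat 1) *v v))" .
qed

text \<open>The instrument that measures \<open>A\<close> and then prepares the maximally mixed state.\<close>

definition trivial_choi :: "'n::finite op \<Rightarrow> ('n \<times> 'n) op" where
  "trivial_choi A = (1 / CARD('n)) *\<^sub>R (A \<otimes>\<^sub>o mat 1)"

lemma pos_op_trivial_choi: "pos_op A \<Longrightarrow> pos_op (trivial_choi A)"
  by (simp add: trivial_choi_def pos_op_scaleR pos_op_tensor_mat_1)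

lemma choi_dual_trivial_choi:
  "choi_dual (trivial_choi (A :: 'n::finite op)) X = mat (trace X / of_nat CARD('n)) ** A"
  unfolding trivial_choi_def choi_dual_scaleR choi_dual_tensor_mat_1
  by (simp add: vec_eq_iff mat_mult_nth) (simp add: scaleR_conv_of_real)

lemma choi_dual_trivial_choi_mat_1: "choi_dual (trivial_choi A) (mat 1) = A"
  by (simp add: choi_dual_trivial_choi trace_I)

lemma observable_le_mat_1:
  assumes "observable B" shows "pos_op (mat 1 - B y)"
proof -
  have "mat 1 - B y = (\<Sum>y'\<in>UNIV - {y}. B y')"
    using assms by (simp add: observable_def sum_diff1)
  then show ?thesis using assms by (auto simp: observable_def intro: pos_op_sum)
qed

section \<open>The set of attainable disturbances\<close>

text \<open>Under the trivial instrument the adjoint sends \<open>B y\<close> to a multiple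
  \<open>r\<close> of the identity, with \<open>r\<close> the normalised trace of
  \<open>B y\<close>. Both operators lie between 0 and the identity, so they differ by at most
  1.\<close>

lemma disturbance_set_one:
  fixes A :: "'x::finite \<Rightarrow> 'n::finite op" and B :: "'y::finite \<Rightarrow> 'n op"
  assumes A: "observable A" and B: "observable B"
  shows "1 \<in> disturbance_set A B"
proof -
  have "(- 1) *\<^sub>R mat 1 \<preceq> B y - (\<Sum>x\<in>UNIV. choi_dual (trivial_choi (A x)) (B y)) \<and>
    B y - (\<Sum>x\<in>UNIV. choi_dual (trivial_choi (A x)) (B y)) \<preceq> 1 *\<^sub>R mat 1" for y
  proof -
    define r where "r = Re (trace (B y)) / CARD('n)"
    have "pos_op (B y)" using B by (simp add: observable_def)
    then have tr: "Im (trace (B y)) = 0" "0 \<le> Re (trace (B y))"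
      using pos_op_trace_nonneg nonneg_complex_iff by blast+
    have "0 \<le> Re (trace (mat 1 - B y))"
      using pos_op_trace_nonneg[OF observable_le_mat_1[OF B]] nonneg_complex_iff by blast
    then have r: "0 \<le> r" "r \<le> 1" using tr by (simp_all add: r_def trace_sub trace_I)
    have "trace (B y) / of_nat CARD('n) = of_real r" using tr by (simp add: r_def complex_eq_iff)
    then have "(\<Sum>x\<in>UNIV. choi_dual (trivial_choi (A x)) (B y)) = mat (of_real r) ** (\<Sum>x\<in>UNIV. A x)"
      by (simp only: choi_dual_trivial_choi matrix_mul_sum)
    also have "\<dots> = r *\<^sub>R mat 1"
    proof -
      have "mat (of_real r) = r *\<^sub>R (mat 1 :: 'n op)"
        by (simp add: vec_eq_iff mat_def) (simp add: scaleR_conv_of_real)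
      then show ?thesis using A by (simp add: observable_def)
    qed
    finally have eq: "(\<Sum>x\<in>UNIV. choi_dual (trivial_choi (A x)) (B y)) = r *\<^sub>R mat 1" .
    have "pos_op (B y + (1 - r) *\<^sub>R mat 1)" "pos_op ((mat 1 - B y) + r *\<^sub>R mat 1)"
      using r \<open>pos_op (B y)\<close> observable_le_mat_1[OF B] by (auto intro!: pos_op_add pos_op_scaleR)
    then show ?thesis by (simp add: eq loewner_le_def algebra_simps)
  qed
  then show ?thesis
    unfolding disturbance_set_choi using A
    by (auto simp: observable_def intro!: exI[of _ "\<lambda>x. trivial_choi (A x)"] pos_op_trivial_choi
        choi_dual_trivial_choi_mat_1)
qed

lemma norm_vec_le_sum: "norm v \<le> (\<Sum>i\<in>UNIV. norm (v $ i))"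
  by (simp add: norm_vec_def L2_set_le_sum)

text \<open>Finite families are coded as vectors so that they live in a Euclidean space, where
  closed and bounded sets are compact.\<close>

lemma compact_vec:
  fixes S :: "'a::euclidean_space set"
  assumes "compact S" shows "compact {v :: 'a^'x::finite. \<forall>x. v $ x \<in> S}"
proof -
  obtain N where N: "\<And>s. s \<in> S \<Longrightarrow> norm s \<le> N"
    using compact_imp_bounded[OF assms] by (auto simp: bounded_iff)
  have "norm v \<le> (\<Sum>x\<in>(UNIV :: 'x set). N)" if "\<forall>x. v $ x \<in> S" for v :: "'a^'x"
    using that by (intro order_trans[OF norm_vec_le_sum] sum_mono N) auto
  then have "bounded {v :: 'a^'x. \<forall>x. v $ x \<in> S}" unfolding bounded_iff by blast
  moreover have "{v :: 'a^'x. \<forall>x. v $ x \<in> S} = (\<Inter>x. (\<lambda>v. v $ x) -` S)" by auto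
  then have "closed {v :: 'a^'x. \<forall>x. v $ x \<in> S}"
    by (auto intro!: closed_INT closed_vimage compact_imp_closed[OF assms] continuous_intros)
  ultimately show ?thesis by (simp add: compact_eq_bounded_closed)
qed

lemma closed_Collect_pos_op: "continuous_on UNIV f \<Longrightarrow> closed {p. pos_op (f p)}"
  using closed_vimage[OF closed_pos_op, of f] by (simp add: vimage_def)

text \<open>The set is the projection to the first coordinate of a compact set of pairs of a bound
  and a Choi family.\<close>

lemma compact_disturbance_set:
  fixes A :: "'x::finite \<Rightarrow> 'n::finite op" and B :: "'y::finite \<Rightarrow> 'n op"
  assumes A: "observable A"
  shows "compact (disturbance_set A B)"
proof -
  \<comment> \<open>The constraint fixes the trace of each Choi operator as that of
    \<open>A x\<close>, which is one of the nonnegative summands of \<open>N\<close>.\<close>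
  define N where "N = (\<Sum>x\<in>UNIV. Re (trace (A x)))"
  define Q where "Q = {0..1::real} \<times> {C :: ('n \<times> 'n) op^'x. \<forall>x. C $ x \<in> {C. pos_op C \<and> Re (trace C) \<le> N}}"
  define F where "F = {p :: real \<times> (('n \<times> 'n) op^'x). (\<forall>x. choi_dual (snd p $ x) (mat 1) = A x) \<and>
    (\<forall>y. pos_op (B y - (\<Sum>x\<in>UNIV. choi_dual (snd p $ x) (B y)) - (- fst p) *\<^sub>R mat 1)) \<and>
    (\<forall>y. pos_op (fst p *\<^sub>R mat 1 - (B y - (\<Sum>x\<in>UNIV. choi_dual (snd p $ x) (B y)))))}"
  have "compact Q" unfolding Q_def by (intro compact_Times compact_vec compact_pos_op) simp
  moreover have "closed F"
    unfolding F_def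
    by (intro closed_Collect_conj closed_Collect_all closed_Collect_pos_op closed_Collect_eq continuous_intros
        continuous_on_choi_dual)
  ultimately have "compact (fst ` (Q \<inter> F))"
    by (intro compact_continuous_image compact_Int_closed continuous_intros)
  moreover have "disturbance_set A B = fst ` (Q \<inter> F)"
  proof (intro set_eqI iffI)
    fix t assume "t \<in> disturbance_set A B"
    then obtain C where C: "0 \<le> t" "t \<le> 1" "\<And>x. pos_op (C x)" "\<And>x. choi_dual (C x) (mat 1) = A x"
      "\<And>y. (- t) *\<^sub>R mat 1 \<preceq> B y - (\<Sum>x\<in>UNIV. choi_dual (C x) (B y))"
      "\<And>y. B y - (\<Sum>x\<in>UNIV. choi_dual (C x) (B y)) \<preceq> t *\<^sub>R mat 1"
      unfolding disturbance_set_choi by blast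
    have "0 \<le> Re (trace (A x))" for x
      using A pos_op_trace_nonneg by (auto simp: observable_def nonneg_complex_iff)
    then have "Re (trace (A x)) \<le> N" for x
      unfolding N_def by (intro member_le_sum) auto
    then have "Re (trace (C x)) \<le> N" for x
      by (simp add: C(4) flip: trace_choi)
    then have "(t, \<chi> x. C x) \<in> Q \<inter> F"
      using C by (simp add: Q_def F_def loewner_le_def)
    then show "t \<in> fst ` (Q \<inter> F)" by force
  next
    fix t assume "t \<in> fst ` (Q \<inter> F)"
    then obtain C where "(t, C) \<in> Q" "(t, C) \<in> F" by auto
    then show "t \<in> disturbance_set A B"
      unfolding disturbance_set_choi loewner_le_def Q_def F_def
      by (auto intro!: exI[of _ "\<lambda>x. C $ x"])
  qed
  ultimately show ?thesis by simp
qed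

section \<open>Duality\<close>

text \<open>Pairing a Choi family with the slack of the dual constraint separates the contribution
  of \<open>K\<close> from that of \<open>H\<close>. Both directions of the duality are read off
  from this identity.\<close>

lemma choi_lagrangian:
  fixes C :: "'x::finite \<Rightarrow> ('n::finite \<times> 'n) op"
  shows "(\<Sum>x\<in>UNIV. Re (trace (C x ** ((\<Sum>y\<in>UNIV. K y \<otimes>\<^sub>o transpose (B y)) - H x \<otimes>\<^sub>o mat 1)))) =
    (\<Sum>y\<in>UNIV. Re (trace (K y ** (\<Sum>x\<in>UNIV. choi_dual (C x) (B y))))) -
    (\<Sum>x\<in>UNIV. Re (trace (H x ** choi_dual (C x) (mat 1))))"
proof -
  have "(\<Sum>x\<in>UNIV. \<Sum>y\<in>UNIV. Re (trace (C x ** (K y \<otimes>\<^sub>o transpose (B y))))) =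
    (\<Sum>y\<in>UNIV. \<Sum>x\<in>UNIV. Re (trace (C x ** (K y \<otimes>\<^sub>o transpose (B y)))))"
    by (rule sum.swap)
  then show ?thesis
    by (simp add: matrix_diff_ldistrib matrix_mul_sum trace_sub trace_sum trace_choi_dual transpose_mat sum_subtractf)
qed

text \<open>Positive operators pair nonnegatively with the slack, which bounds the value by the
  pairing of \<open>K\<close> with the change of \<open>B\<close>; the trace norm bound then gives
  \<open>t\<close>.\<close>

lemma weak_duality:
  assumes "dual_feasible B H K" "t \<in> disturbance_set A B"
  shows "dual_value A B H K \<le> t"
proof -
  obtain C where C: "\<And>x. pos_op (C x)" "\<And>x. choi_dual (C x) (mat 1) = A x"
    "\<And>y. (- t) *\<^sub>R mat 1 \<preceq> B y - (\<Sum>x\<in>UNIV. choi_dual (C x) (B y))"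
    "\<And>y. B y - (\<Sum>x\<in>UNIV. choi_dual (C x) (B y)) \<preceq> t *\<^sub>R mat 1"
    using assms(2) unfolding disturbance_set_choi by blast
  define \<Phi> where "\<Phi> = (\<lambda>y. \<Sum>x\<in>UNIV. choi_dual (C x) (B y))"
  have K: "\<And>y. selfadj (K y)" and tn: "(\<Sum>y\<in>UNIV. trace (op_abs (K y))) = 1"
    and HK: "\<And>x. pos_op ((\<Sum>y\<in>UNIV. K y \<otimes>\<^sub>o transpose (B y)) - H x \<otimes>\<^sub>o mat 1)"
    using assms(1) by (auto simp: dual_feasible_def loewner_le_def)
  have "0 \<le> (\<Sum>x\<in>UNIV. Re (trace (C x ** ((\<Sum>y\<in>UNIV. K y \<otimes>\<^sub>o transpose (B y)) - H x \<otimes>\<^sub>o mat 1))))"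
    by (intro sum_nonneg trace_mult_pos_op C HK)
  then have "(\<Sum>x\<in>UNIV. Re (trace (H x ** A x))) \<le> (\<Sum>y\<in>UNIV. Re (trace (K y ** \<Phi> y)))"
    unfolding choi_lagrangian by (simp add: C(2) \<Phi>_def)
  then have "dual_value A B H K \<le> (\<Sum>y\<in>UNIV. Re (trace (K y ** (\<Phi> y - B y))))"
    by (simp add: dual_value_def matrix_diff_ldistrib trace_sub sum_subtractf)
  also have "\<dots> \<le> (\<Sum>y\<in>UNIV. t * Re (trace (op_abs (K y))))"
  proof (intro sum_mono trace_norm_upper K)
    show "(- t) *\<^sub>R mat 1 \<preceq> \<Phi> y - B y" "\<Phi> y - B y \<preceq> t *\<^sub>R mat 1" for y
      using C(3,4)[of y] by (simp_all add: loewner_le_def \<Phi>_def algebra_simps)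
  qed
  also have "\<dots> = t * Re (\<Sum>y\<in>UNIV. trace (op_abs (K y)))" by (simp add: sum_distrib_left)
  finally show ?thesis by (simp add: tn)
qed

text \<open>All \<open>H x\<close> and \<open>K y\<close> are the same multiple of the identity, and
  \<open>c\<close> makes the trace norms add up to 1. As the \<open>B y\<close> sum to the identity,
  the constraint is an equality and the two trace sums cancel.\<close>

lemma dual_values_zero:
  fixes A :: "'x::finite \<Rightarrow> 'n::finite op" and B :: "'y::finite \<Rightarrow> 'n op"
  assumes A: "observable A" and B: "observable B"
  shows "0 \<in> dual_values A B"
proof -
  define c where "c = 1 / (real CARD('n) * real CARD('y))"
  have c: "c \<ge> 0" by (simp add: c_def)
  define I where "I = c *\<^sub>R (mat 1 :: 'n op)"
  have "op_abs I = I" unfolding I_def using op_abs_scaleR[OF selfadj_mat_1 c] by (simp add: op_abs_mat_1)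
  then have "(\<Sum>y\<in>(UNIV :: 'y set). trace (op_abs I)) = 1"
    by (simp add: I_def trace_scaleR trace_I c_def scaleR_conv_of_real[where 'a = complex])
  moreover have "selfadj I" by (simp add: I_def selfadj_scaleR)
  moreover have "(\<Sum>y\<in>UNIV. I \<otimes>\<^sub>o transpose (B y)) = I \<otimes>\<^sub>o mat 1"
    using B by (simp add: observable_def transpose_mat flip: tensor_sum_right transpose_sum)
  ultimately have "dual_feasible B (\<lambda>x::'x. I) (\<lambda>y. I)"
    by (simp add: dual_feasible_def loewner_le_def)
  moreover have "dual_value A B (\<lambda>x. I) (\<lambda>y. I) = 0"
    using A B by (simp add: dual_value_def observable_def flip: trace_sum matrix_mul_sum)
  ultimately show ?thesis unfolding dual_values_def by (metis (mono_tags, lifting) mem_Collect_eq)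
qed

section \<open>Preparations for the separation argument\<close>

lemma matrix_add_rdistrib: "(A + B :: complex^'n^'m) ** C = A ** C + B ** C"
  by (simp add: matrix_matrix_mult_def vec_eq_iff distrib_right sum.distrib)

lemma matrix_mul_minus_left: "(- A) ** B = - (A ** B :: complex^'n^'m)"
  by (simp add: matrix_matrix_mult_def vec_eq_iff sum_negf)

lemma trace_minus: "trace (- A) = - trace (A :: complex^'n^'n)"
  by (simp add: trace_def sum_negf)

text \<open>A separating functional is given by arbitrary matrices; on selfadjoint arguments only
  their hermitian parts act.\<close>

definition herm :: "'n::finite op \<Rightarrow> 'n op" where
  "herm X = (1 / 2) *\<^sub>R (X + adj X)"

lemma selfadj_herm: "selfadj (herm X)"
  by (simp add: herm_def selfadj_def adj_scaleR adj_add add.commute)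

lemma inner_herm:
  assumes "selfadj Y" shows "X \<bullet> Y = Re (trace (herm X ** Y))"
proof -
  have "X \<bullet> Y = Re (trace (Y ** X))"
    using assms inner_op[of Y X] by (simp add: selfadj_def inner_commute)
  then show ?thesis
    by (simp add: herm_def scaleR_matrix_mul matrix_add_rdistrib trace_scaleR trace_add inner_op[of X Y]
        trace_mul_sym[of Y X])
qed

text \<open>A convergent sequence in \<open>S\<close> is bounded and so stays in one compact subset
  of \<open>S\<close>, which contains the limit. This handles the linear image of an unbounded
  cone.\<close>

lemma closed_if_bounded_parts_in_compact:
  fixes S :: "'a::real_normed_vector set"
  assumes "\<And>r. \<exists>T. compact T \<and> T \<subseteq> S \<and> (\<forall>z\<in>S. norm z \<le> r \<longrightarrow> z \<in> T)"
  shows "closed S"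
  unfolding closed_sequential_limits
proof (intro allI impI)
  fix z l assume z: "(\<forall>n. z n \<in> S) \<and> z \<longlonglongrightarrow> l"
  then have "Bseq z" by (blast intro: convergent_imp_Bseq convergentI)
  then obtain r where r: "\<And>n. norm (z n) \<le> r" by (auto simp: Bseq_def)
  obtain T where T: "compact T" "T \<subseteq> S" "\<forall>z\<in>S. norm z \<le> r \<longrightarrow> z \<in> T"
    using assms by blast
  have "l \<in> T"
    using closed_sequentially[OF compact_imp_closed[OF T(1)], of z l] z r T(3) by blast
  then show "l \<in> S" using T(2) by blast
qed

lemma Re_trace_le_norm: "Re (trace M) \<le> CARD('n) * norm M" for M :: "'n::finite op"
proof -
  have "Re (M $ i $ i) \<le> norm M" for i
    using complex_Re_le_cmod[of "M $ i $ i"] Finite_Cartesian_Product.norm_nth_le[of "M $ i" i]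
      Finite_Cartesian_Product.norm_nth_le[of M i] by linarith
  then have "(\<Sum>i\<in>UNIV. Re (M $ i $ i)) \<le> (\<Sum>i\<in>(UNIV :: 'n set). norm M)" by (intro sum_mono) auto
  then show ?thesis by (simp add: trace_def)
qed

lemma loewner_interval_compact: "compact {R :: 'n::finite op. (- s) *\<^sub>R mat 1 \<preceq> R \<and> R \<preceq> s *\<^sub>R mat 1}"
proof -
  \<comment> \<open>Adding \<open>s *\<^sub>R mat 1\<close> turns the interval into positive
    operators bounded above by \<open>(2 * s) *\<^sub>R mat 1\<close>; \<open>N\<close> is the trace
    of that bound.\<close>
  define N where "N = 2 * s * CARD('n)"
  have "{R :: 'n op. (- s) *\<^sub>R mat 1 \<preceq> R \<and> R \<preceq> s *\<^sub>R mat 1} =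
    (\<lambda>P. P - s *\<^sub>R mat 1) ` {P. pos_op P \<and> Re (trace P) \<le> N} \<inter> {R. pos_op (s *\<^sub>R mat 1 - R)}"
  proof (intro set_eqI iffI)
    fix R :: "'n op" assume "R \<in> {R. (- s) *\<^sub>R mat 1 \<preceq> R \<and> R \<preceq> s *\<^sub>R mat 1}"
    then have R: "pos_op (R + s *\<^sub>R mat 1)" "pos_op (s *\<^sub>R mat 1 - R)" by (simp_all add: loewner_le_def)
    have "Re (trace (R + s *\<^sub>R mat 1)) \<le> N"
      using pos_op_trace_nonneg[OF R(2)]
      by (simp add: N_def trace_sub trace_add trace_scaleR trace_I nonneg_complex_iff)
    then show "R \<in> (\<lambda>P. P - s *\<^sub>R mat 1) ` {P. pos_op P \<and> Re (trace P) \<le> N} \<inter> {R. pos_op (s *\<^sub>R mat 1 - R)}"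
      using R by (auto intro!: image_eqI[of _ _ "R + s *\<^sub>R mat 1"])
  qed (auto simp: loewner_le_def)
  also have "compact \<dots>"
    by (intro compact_Int_closed compact_continuous_image compact_pos_op closed_Collect_pos_op continuous_intros)
  finally show ?thesis .
qed

lemma loewner_interval_convex: "convex {R :: 'n::finite op. (- s) *\<^sub>R mat 1 \<preceq> R \<and> R \<preceq> s *\<^sub>R mat 1}"
proof (rule convexI)
  fix R R' :: "'n op" and u v :: real
  let ?I = "s *\<^sub>R (mat 1 :: 'n op)"
  assume R: "R \<in> {R. (- s) *\<^sub>R mat 1 \<preceq> R \<and> R \<preceq> s *\<^sub>R mat 1}"
    "R' \<in> {R. (- s) *\<^sub>R mat 1 \<preceq> R \<and> R \<preceq> s *\<^sub>R mat 1}"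
    and uv: "0 \<le> u" "0 \<le> v" "u + v = 1"
  have I: "u *\<^sub>R ?I + v *\<^sub>R ?I = ?I" unfolding scaleR_left_distrib[symmetric] uv(3) by (rule scaleR_one)
  have "pos_op (u *\<^sub>R (R + ?I) + v *\<^sub>R (R' + ?I))" "pos_op (u *\<^sub>R (?I - R) + v *\<^sub>R (?I - R'))"
    using R uv by (auto intro!: pos_op_add pos_op_scaleR simp: loewner_le_def)
  moreover have "u *\<^sub>R (R + ?I) + v *\<^sub>R (R' + ?I) = u *\<^sub>R R + v *\<^sub>R R' + (u *\<^sub>R ?I + v *\<^sub>R ?I)"
    "u *\<^sub>R (?I - R) + v *\<^sub>R (?I - R') = (u *\<^sub>R ?I + v *\<^sub>R ?I) - (u *\<^sub>R R + v *\<^sub>R R')"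
    by (simp_all add: scaleR_add_right scaleR_diff_right)
  ultimately show "u *\<^sub>R R + v *\<^sub>R R' \<in> {R. (- s) *\<^sub>R mat 1 \<preceq> R \<and> R \<preceq> s *\<^sub>R mat 1}"
    unfolding I by (simp add: loewner_le_def)
qed

lemma convex_vec: "convex S \<Longrightarrow> convex {v :: 'a::real_vector^'x. \<forall>x. v $ x \<in> S}"
  by (simp add: convex_def)

lemma strong_duality:
  fixes A :: "'x::finite \<Rightarrow> 'n::finite op" and B :: "'y::finite \<Rightarrow> 'n op"
  assumes A: "observable A" and B: "observable B"
    and s: "0 \<le> s" "s \<le> 1" "s \<notin> disturbance_set A B"
  obtains H K where "dual_feasible B H K" "s < dual_value A B H K"
proof -
  define I where "I = {R :: 'n op. (- s) *\<^sub>R mat 1 \<preceq> R \<and> R \<preceq> s *\<^sub>R mat 1}"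
  define R_set where "R_set = {R :: 'n op^'y. \<forall>y. R $ y \<in> I}"
  define P_set where "P_set = {C :: ('n \<times> 'n) op^'x. \<forall>x. C $ x \<in> {C. pos_op C}}"
  define f :: "(('n \<times> 'n) op^'x) \<times> ('n op^'y) \<Rightarrow> ('n op^'x) \<times> ('n op^'y)" where
    "f = (\<lambda>(C, R). (\<chi> x. choi_dual (C $ x) (mat 1), \<chi> y. R $ y - (\<Sum>x\<in>UNIV. choi_dual (C $ x) (B y))))"
  define z0 :: "('n op^'x) \<times> ('n op^'y)" where "z0 = (\<chi> x. A x, \<chi> y. - B y)"
  have Asa: "selfadj (A x)" and Bsa: "selfadj (B y)" for x y
    using A B pos_op_selfadj by (auto simp: observable_def)
  have lin: "linear f"
    by (rule linearI) (auto simp: f_def prod_eq_iff vec_eq_iff choi_dual_add choi_dual_scaleR sum.distrib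
        scaleR_sum_right scaleR_diff_right algebra_simps)
  have "compact I" unfolding I_def by (rule loewner_interval_compact)
  then have "compact R_set" unfolding R_set_def by (rule compact_vec)
  have "convex R_set" unfolding R_set_def I_def by (intro convex_vec loewner_interval_convex)
  have "convex P_set" unfolding P_set_def by (intro convex_vec convex_pos_op)
  have "convex (f ` (P_set \<times> R_set))"
    by (intro convex_linear_image lin convex_Times \<open>convex R_set\<close> \<open>convex P_set\<close>)
  moreover have "closed (f ` (P_set \<times> R_set))"
  proof (rule closed_if_bounded_parts_in_compact)
    fix r :: real
    \<comment> \<open>A norm bound \<open>r\<close> on \<open>choi_dual (C $ x) (mat 1)\<close>
      bounds its trace by \<open>N\<close>, and that trace is the trace of
      \<open>C $ x\<close>.\<close>
    define N where "N = CARD('n) * r"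
    define Q where "Q = {C :: ('n \<times> 'n) op^'x. \<forall>x. C $ x \<in> {C. pos_op C \<and> Re (trace C) \<le> N}}"
    have "compact (f ` (Q \<times> R_set))"
      unfolding Q_def
      by (intro compact_continuous_image linear_continuous_on linear_conv_bounded_linear[THEN iffD1] lin
          compact_Times compact_vec compact_pos_op \<open>compact R_set\<close>)
    moreover have "f ` (Q \<times> R_set) \<subseteq> f ` (P_set \<times> R_set)"
      by (auto simp: Q_def P_set_def)
    moreover have "f (C, R) \<in> f ` (Q \<times> R_set)" if "C \<in> P_set" "R \<in> R_set" "norm (f (C, R)) \<le> r" for C R
    proof -
      have "Re (trace (C $ x)) \<le> N" for x
      proof -
        have "norm (choi_dual (C $ x) (mat 1)) \<le> norm (fst (f (C, R)))"
          using Finite_Cartesian_Product.norm_nth_le[of "fst (f (C, R))" x] by (simp add: f_def)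
        also have "\<dots> \<le> r" using norm_fst_le[of "fst (f (C, R))" "snd (f (C, R))"] that(3) by simp
        finally show ?thesis
          using Re_trace_le_norm[of "choi_dual (C $ x) (mat 1)"] unfolding trace_choi N_def
          by (meson mult_left_mono of_nat_0_le_iff order_trans)
      qed
      then show ?thesis using that(1,2) by (auto simp: Q_def P_set_def)
    qed
    ultimately show "\<exists>T. compact T \<and> T \<subseteq> f ` (P_set \<times> R_set) \<and> (\<forall>z\<in>f ` (P_set \<times> R_set). norm z \<le> r \<longrightarrow> z \<in> T)"
      by (intro exI[of _ "f ` (Q \<times> R_set)"]) auto
  qed
  moreover have "z0 \<notin> f ` (P_set \<times> R_set)"
  proof
    assume "z0 \<in> f ` (P_set \<times> R_set)"
    then obtain C R where CR: "C \<in> P_set" "R \<in> R_set" "z0 = f (C, R)" by auto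
    have "choi_dual (C $ x) (mat 1) = A x" for x
      using arg_cong[OF CR(3), of "\<lambda>z. fst z $ x"] by (simp add: z0_def f_def)
    moreover have "R $ y = (\<Sum>x\<in>UNIV. choi_dual (C $ x) (B y)) - B y" for y
      using arg_cong[OF CR(3), of "\<lambda>z. snd z $ y + (\<Sum>x\<in>UNIV. choi_dual (C $ x) (B y))"]
      by (simp add: z0_def f_def)
    then have "B y - (\<Sum>x\<in>UNIV. choi_dual (C $ x) (B y)) = - R $ y" for y by simp
    moreover have "(- s) *\<^sub>R mat 1 \<preceq> - R $ y \<and> - R $ y \<preceq> s *\<^sub>R mat 1" for y
      using CR(2) by (simp add: R_set_def I_def loewner_le_def add.commute)
    ultimately have "s \<in> disturbance_set A B"
      unfolding disturbance_set_choi using CR(1) s(1,2)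
      by (auto simp: P_set_def intro!: exI[of _ "\<lambda>x. C $ x"])
    then show False using s(3) by blast
  qed
  ultimately obtain a b where ab: "a \<bullet> z0 < b" "\<And>z. z \<in> f ` (P_set \<times> R_set) \<Longrightarrow> b < a \<bullet> z"
    using separating_hyperplane_closed_point by metis
  \<comment> \<open>The minus signs turn the value of the functional at \<open>z0\<close> into
    \<open>- V\<close>, with \<open>V\<close> the dual value before normalisation.\<close>
  define H where "H = (\<lambda>x. - herm (fst a $ x))"
  define K where "K = (\<lambda>y. - herm (snd a $ y))"
  have H: "selfadj (H x)" and K: "selfadj (K y)" for x y
    using selfadj_diff[OF selfadj_0 selfadj_herm] by (auto simp: H_def K_def)
  define M where "M = (\<Sum>y\<in>UNIV. K y \<otimes>\<^sub>o transpose (B y))"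
  define V where "V = (\<Sum>x\<in>UNIV. Re (trace (H x ** A x))) - (\<Sum>y\<in>UNIV. Re (trace (K y ** B y)))"
  have inner_a: "a \<bullet> z = - (\<Sum>x\<in>UNIV. Re (trace (H x ** fst z $ x))) - (\<Sum>y\<in>UNIV. Re (trace (K y ** snd z $ y)))"
    if "\<And>x. selfadj (fst z $ x)" "\<And>y. selfadj (snd z $ y)" for z
    using that
    by (simp add: H_def K_def inner_prod_def inner_vec_def[of "fst _"] inner_vec_def[of "snd _"] inner_herm
        matrix_mul_minus_left trace_minus sum_negf)
  \<comment> \<open>This is the separation inequality in Lagrangian form. Dual feasibility and the
    bound on the value follow by inserting particular \<open>C\<close> and \<open>R\<close>.\<close>
  have key: "(\<Sum>y\<in>UNIV. Re (trace (K y ** R y))) < V + (\<Sum>x\<in>UNIV. Re (trace (C x ** (M - H x \<otimes>\<^sub>o mat 1))))"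
    if C: "\<And>x. pos_op (C x)" and R: "\<And>y. (- s) *\<^sub>R mat 1 \<preceq> R y" "\<And>y. R y \<preceq> s *\<^sub>R mat 1" for C R
  proof -
    let ?z = "f (\<chi> x. C x, \<chi> y. R y)"
    have Csa: "selfadj (C x)" for x using C pos_op_selfadj by blast
    have Rsa: "selfadj (R y)" for y
      using selfadj_diff[OF selfadj_scaleR[OF selfadj_mat_1, of s] pos_op_selfadj[OF R(2)[unfolded loewner_le_def], of y]]
      by simp
    have "?z \<in> f ` (P_set \<times> R_set)" using C R by (auto simp: P_set_def R_set_def I_def)
    then have "a \<bullet> z0 < a \<bullet> ?z" using ab by fastforce
    moreover have "a \<bullet> z0 = - V"
      by (subst inner_a) (auto simp: z0_def V_def Asa Bsa selfadj_diff[OF selfadj_0 Bsa, simplified]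
          matrix_diff_ldistrib[of _ 0, simplified] trace_minus sum_negf)
    moreover have "a \<bullet> ?z = (\<Sum>x\<in>UNIV. Re (trace (C x ** (M - H x \<otimes>\<^sub>o mat 1)))) - (\<Sum>y\<in>UNIV. Re (trace (K y ** R y)))"
      unfolding M_def choi_lagrangian
      by (subst inner_a) (auto simp: f_def selfadj_choi_dual Csa Bsa Rsa selfadj_diff selfadj_sum matrix_diff_ldistrib
          trace_sub sum_subtractf)
    ultimately show ?thesis by linarith
  qed
  have zero_R: "(- s) *\<^sub>R mat 1 \<preceq> (0 :: 'n op)" "(0 :: 'n op) \<preceq> s *\<^sub>R mat 1"
    using s(1) by (auto simp: loewner_le_def pos_op_scaleR)
  have Msa: "selfadj (M - H x \<otimes>\<^sub>o mat 1)" for x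
    unfolding M_def by (intro selfadj_diff selfadj_sum selfadj_tensor K H selfadj_transpose Bsa selfadj_mat_1)
  have HM: "pos_op (M - H x \<otimes>\<^sub>o mat 1)" for x
  proof (rule pos_opI[OF Msa], rule ccontr)
    fix w
    define q where "q = Re (cinner w ((M - H x \<otimes>\<^sub>o mat 1) *v w))"
    assume "\<not> 0 \<le> Re (cinner w ((M - H x \<otimes>\<^sub>o mat 1) *v w))"
    then have q: "q < 0" by (simp add: q_def)
    \<comment> \<open>A multiple of \<open>rank1 w\<close> in the single slot \<open>x\<close> would push the separating functional below its bound.\<close>
    define c where "c = \<bar>V\<bar> / - q"
    have c: "c \<ge> 0" using q by (auto simp: c_def intro: divide_nonneg_neg)
    define C where "C = (\<lambda>x'. if x' = x then c *\<^sub>R rank1 w else 0)"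
    have "pos_op (C x')" for x' using c by (simp add: C_def pos_op_scaleR pos_op_rank1)
    from key[of C "\<lambda>_. 0", OF this zero_R]
    have "0 < V + (\<Sum>x'\<in>UNIV. Re (trace (C x' ** (M - H x' \<otimes>\<^sub>o mat 1))))" by (simp add: trace_0[unfolded mat_0])
    also have "(\<Sum>x'\<in>UNIV. Re (trace (C x' ** (M - H x' \<otimes>\<^sub>o mat 1)))) =
      (\<Sum>x'\<in>UNIV. if x' = x then c * q else 0)"
      by (intro sum.cong refl)
        (auto simp: C_def scaleR_matrix_mul trace_scaleR trace_mul_sym[of "rank1 w"] trace_mult_rank1
          q_def trace_0[unfolded mat_0])
    also have "\<dots> = c * q" by simp
    also have "c * q = - \<bar>V\<bar>" using q by (simp add: c_def)
    finally show False by linarith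
  qed
  define n where "n = (\<Sum>y\<in>UNIV. Re (trace (op_abs (K y))))"
  have nK: "0 \<le> Re (trace (op_abs (K y)))" "Im (trace (op_abs (K y))) = 0" for y
    using pos_op_trace_nonneg[OF pos_op_abs[OF K]] by (auto simp: nonneg_complex_iff)
  \<comment> \<open>Taking \<open>C = 0\<close> and for each \<open>R y\<close> the extremal
    operator of the trace norm of \<open>K y\<close> makes the left side of the inequality equal to
    \<open>s * n\<close>.\<close>
  have "V > s * n"
  proof -
    have "\<exists>R. (- s) *\<^sub>R mat 1 \<preceq> R \<and> R \<preceq> s *\<^sub>R mat 1 \<and> Re (trace (K y ** R)) = s * Re (trace (op_abs (K y)))" for y
      using trace_norm_attained[OF K s(1)] by metis
    then obtain R where R: "\<And>y. (- s) *\<^sub>R mat 1 \<preceq> R y" "\<And>y. R y \<preceq> s *\<^sub>R mat 1"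
      "\<And>y. Re (trace (K y ** R y)) = s * Re (trace (op_abs (K y)))" by metis
    from key[of "\<lambda>_. 0" R, OF pos_op_0 R(1,2)] show ?thesis
      by (simp add: R(3) n_def sum_distrib_left trace_0[unfolded mat_0])
  qed
  \<comment> \<open>If \<open>n\<close> were 0, then \<open>K\<close> would vanish. The trivial
    instrument already meets the constraint on \<open>A\<close>, so its Lagrangian term cancels
    \<open>V\<close> and the inequality would read \<open>0 < 0\<close>.\<close>
  have "n > 0"
  proof (rule ccontr)
    assume "\<not> n > 0"
    then have "n = 0" using nK(1) by (simp add: n_def sum_nonneg order_antisym not_less)
    then have "Re (trace (op_abs (K y))) = 0" for y
      using nK(1) by (simp add: n_def sum_nonneg_eq_0_iff)
    then have K0: "K = (\<lambda>y. 0)" using op_abs_trace_0[OF K] by blast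
    have "pos_op (trivial_choi (A x))" for x
      using A by (simp add: observable_def pos_op_trivial_choi)
    from key[of "\<lambda>x. trivial_choi (A x)", OF this zero_R] show False
      unfolding M_def choi_lagrangian choi_dual_trivial_choi_mat_1
      by (simp add: K0 V_def trace_0[unfolded mat_0])
  qed
  \<comment> \<open>The constraint and the value are homogeneous, so division by \<open>n\<close>
    normalises the trace norms and turns \<open>s * n < V\<close> into
    \<open>s < V / n\<close>.\<close>
  define H' where "H' = (\<lambda>x. (1 / n) *\<^sub>R H x)"
  define K' where "K' = (\<lambda>y. (1 / n) *\<^sub>R K y)"
  have "dual_feasible B H' K'"
    unfolding dual_feasible_def
  proof (intro conjI allI)
    show "selfadj (H' x)" "selfadj (K' y)" for x y
      by (simp_all add: H'_def K'_def H K selfadj_scaleR)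
    have "(\<Sum>y\<in>UNIV. K' y \<otimes>\<^sub>o transpose (B y)) - H' x \<otimes>\<^sub>o mat 1 = (1 / n) *\<^sub>R (M - H x \<otimes>\<^sub>o mat 1)" for x
      by (simp add: K'_def H'_def M_def tensor_scaleR_left scaleR_sum_right scaleR_diff_right)
    then show "H' x \<otimes>\<^sub>o mat 1 \<preceq> (\<Sum>y\<in>UNIV. K' y \<otimes>\<^sub>o transpose (B y))" for x
      using HM \<open>n > 0\<close> by (simp add: loewner_le_def pos_op_scaleR)
    have "trace (op_abs (K y)) = of_real (Re (trace (op_abs (K y))))" for y
      using nK(2) by (simp add: complex_eq_iff)
    then have "(\<Sum>y\<in>UNIV. trace (op_abs (K y))) = of_real n"
      unfolding n_def of_real_sum by (intro sum.cong refl)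
    then show "(\<Sum>y\<in>UNIV. trace (op_abs (K' y))) = 1"
      using \<open>n > 0\<close> by (simp add: K'_def op_abs_scaleR K trace_scaleR flip: scaleR_sum_right)
         (simp add: scaleR_conv_of_real[where 'a = complex] flip: sum_divide_distrib)
  qed
  moreover have "dual_value A B H' K' = V / n"
    by (simp add: dual_value_def H'_def K'_def V_def scaleR_matrix_mul trace_scaleR diff_divide_distrib sum_divide_distrib)
  then have "s < dual_value A B H' K'"
    using \<open>V > s * n\<close> \<open>n > 0\<close> by (simp add: less_divide_eq)
  ultimately show ?thesis using that by blast
qed

text \<open>Nonemptiness and boundedness of the dual values are part of the claim because they make
  the real \<open>Sup\<close> a genuine supremum.\<close>

theorem mainTheorem6:
  fixes A :: "'x::finite \<Rightarrow> 'n::finite op"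
    and B :: "'y::finite \<Rightarrow> 'n op"
  assumes "observable A" and "observable B"
  shows "disturbance A B \<in> disturbance_set A B
    \<and> (disturbance A B = 0 \<longleftrightarrow> measurable_without_disturbing A B)
    \<and> dual_values A B \<noteq> {} \<and> bdd_above (dual_values A B)
    \<and> disturbance A B = Sup (dual_values A B)"
proof -
  let ?D = "disturbance A B"
  have bdd: "bdd_below (disturbance_set A B)"
    by (rule bdd_belowI[of _ 0]) (simp add: disturbance_set_def)
  have D: "?D \<in> disturbance_set A B"
    unfolding disturbance_def using disturbance_set_one[OF assms] bdd compact_disturbance_set[OF assms(1)]
    by (intro closed_contains_Inf) (auto intro: compact_imp_closed)
  have D_le: "?D \<le> t" if "t \<in> disturbance_set A B" for t
    unfolding disturbance_def using that bdd by (rule cInf_lower)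
  have D01: "0 \<le> ?D" "?D \<le> 1" using D by (auto simp: disturbance_set_def)
  have "?D = 0 \<longleftrightarrow> measurable_without_disturbing A B"
  proof
    assume "?D = 0"
    then have "0 \<in> disturbance_set A B" using D by simp
    then obtain C where C: "\<And>x. pos_op (C x)" "\<And>x. choi_dual (C x) (mat 1) = A x"
      "\<And>y. (- 0) *\<^sub>R mat 1 \<preceq> B y - (\<Sum>x\<in>UNIV. choi_dual (C x) (B y))"
      "\<And>y. B y - (\<Sum>x\<in>UNIV. choi_dual (C x) (B y)) \<preceq> 0 *\<^sub>R mat 1"
      unfolding disturbance_set_choi by blast
    have "(\<Sum>x\<in>UNIV. choi_dual (C x) (B y)) = B y" for y
      using pos_op_antisym[of "B y - (\<Sum>x\<in>UNIV. choi_dual (C x) (B y))"] C(3,4)[of y]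
      by (simp add: loewner_le_def)
    then show "measurable_without_disturbing A B"
      unfolding measurable_iff_choi using C(1,2) by blast
  next
    assume "measurable_without_disturbing A B"
    then obtain C where C: "\<And>x. pos_op (C x)" "\<And>x. choi_dual (C x) (mat 1) = A x"
      "\<And>y. (\<Sum>x\<in>UNIV. choi_dual (C x) (B y)) = B y"
      unfolding measurable_iff_choi by blast
    have "0 \<in> disturbance_set A B"
      unfolding disturbance_set_choi mem_Collect_eq
      by (intro conjI exI[of _ C] allI) (simp_all only: C, simp_all add: loewner_le_def)
    then show "?D = 0" using D_le[of 0] D01 by simp
  qed
  moreover have ne: "dual_values A B \<noteq> {}" using dual_values_zero[OF assms] by blast
  moreover have le: "v \<le> ?D" if "v \<in> dual_values A B" for v
    using that weak_duality[OF _ D] by (auto simp: dual_values_def)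
  then have bdd_dual: "bdd_above (dual_values A B)" by (rule bdd_aboveI)
  moreover have "?D = Sup (dual_values A B)"
  proof (rule antisym)
    show "Sup (dual_values A B) \<le> ?D" using ne le by (rule cSup_least)
    show "?D \<le> Sup (dual_values A B)"
    \<comment> \<open>Each unattainable \<open>s\<close> in the unit interval is exceeded by a dual
      value. A negative \<open>s\<close> is outside the range of \<open>strong_duality\<close> and
      is covered by the dual value 0.\<close>
    proof (rule dense_le)
      fix s assume "s < ?D"
      show "s \<le> Sup (dual_values A B)"
      proof (cases "0 \<le> s")
        case True
        have "s \<notin> disturbance_set A B" using D_le[of s] \<open>s < ?D\<close> by linarith
        moreover have "s \<le> 1" using \<open>s < ?D\<close> D01 by linarith
        ultimately obtain H K where HK: "dual_feasible B H K" "s < dual_value A B H K"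
          using strong_duality[OF assms True] by blast
        then have "dual_value A B H K \<in> dual_values A B" unfolding dual_values_def by blast
        then show ?thesis using cSup_upper[OF _ bdd_dual] HK(2) by (meson less_imp_le less_le_trans)
      next
        case False
        then show ?thesis using cSup_upper[OF dual_values_zero[OF assms] bdd_dual] by linarith
      qed
    qed
  qed
  ultimately show ?thesis using D by blast
qed

end
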